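(* A connected graph $G$ is a minimal $(2,2)$-dominated graph if and only if $G$ belongs to the family $\mathcal{F}$, where $\mathcal{F}$ is the smallest family of graphs such that: (1) $\mathcal{F}$ contains the subdivision graph $S(H)$ of every connected graph $H$ (possibly with multi-edges and multi-loops) with $\delta(H)\ge 2$; and (2) whenever $G\in\mathcal{F}$, $v$ is a contractible vertex of $G$ of degree at least $3$, and $\mathcal{P}(v)=\{S_1,S_2\}$ is a partition of $N_G(v)$ with $|S_1|=1$ such that every vertex of $N_G(S_2)\setminus\{v\}$ has degree $2$ in $G$, the $\mathcal{P}$-contraction $G(\mathcal{P}(v))$ also belongs to $\mathcal{F}$.
   Context: Graphs may have multiple edges and loops; degree counts loops twice; $\delta$ denotes minimum degree. The subdivision graph $S(H)$ is obtained from $H$ by inserting a new vertex into each edge and each loop. $N_G(v)$ is the set of neighbours of $v$, $N_G(X)=\bigcup_{x\in X}N_G(x)$, $N_G^2(v)$ the set of vertices at distance exactly $2$ from $v$, $N_G^2[v]$ the set of vertices within distance $2$ of $v$. A set $D\subseteq V(G)$ is $2$-dominating if every vertex of $V(G)\setminus D$ is joined by at least two edges (counted with multiplicity) to vertices of $D$; $G$ is $(2,2)$-dominated if there are two proper, disjoint $2$-dominating subsets of $V(G)$. A connected graph is a minimal $(2,2)$-dominated graph if it is $(2,2)$-dominated and no proper spanning subgraph (obtained by deleting at least one edge) is $(2,2)$-dominated. For a bipartite graph $G$, a vertex $v$ is contractible if it is not incident with a multi-edge. Given a contractible vertex $v$ and a partition $\mathcal{P}(v)$ of $N_G(v)$,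 the $\mathcal{P}$-contraction $G'=G(\mathcal{P}(v))$ has vertex set $(V(G)\setminus N_G(v))\cup\{(v,S):S\in\mathcal{P}(v)\}$ and edges: every vertex $u\notin N_G^2[v]$ keeps exactly its edges of $G$; $v$ is joined by exactly one edge to each $(v,S)$ and to nothing else; each $(v,S)$ has neighbourhood $N_G(S)$; for $u\in N_G^2(v)$, $N_{G'}(u)=\{(v,S): N_G(u)\cap S\neq\emptyset\}\cup(N_G(u)\setminus N_G(v))$, with the number of edges between $u$ and $(v,S)$ equal to the number of edges of $G$ between $u$ and $S$. *)

theory Defs
  imports Main "HOL-Library.Multiset" "HOL-Library.Disjoint_Sets"
begin

text \<open>
  Finite undirected graphs with multiple edges and loops. An edge is the two-element multiset
  of its ends, so a loop at \<open>x\<close> is \<open>{#x, x#}\<close>, and parallel edges are repeated elements of the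
  multiset of edges.
\<close>

record 'a mgraph =
  verts :: "'a set"
  edges :: "'a multiset multiset"

definition is_graph :: "'a mgraph \<Rightarrow> bool" where
  "is_graph G \<longleftrightarrow> finite (verts G) \<and>
     (\<forall>e \<in># edges G. size e = 2 \<and> set_mset e \<subseteq> verts G)"

definition adj :: "'a mgraph \<Rightarrow> ('a \<times> 'a) set" where
  "adj G = {(u, v). {#u, v#} \<in># edges G}"

definition connected_graph :: "'a mgraph \<Rightarrow> bool" where
  "connected_graph G \<longleftrightarrow> verts G \<noteq> {} \<and>
     (\<forall>u \<in> verts G. \<forall>v \<in> verts G. (u, v) \<in> (adj G)\<^sup>*)"

definition bipartite :: "'a mgraph \<Rightarrow> bool" where
  "bipartite G \<longleftrightarrow> (\<exists>A B. A \<union> B = verts G \<and> A \<inter> B = {} \<and>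
     (\<forall>e \<in># edges G. \<exists>a \<in> A. \<exists>b \<in> B. e = {#a, b#}))"

text \<open>A loop at \<open>v\<close> contributes \<open>count {#v, v#} v = 2\<close>.\<close>

definition degree :: "'a mgraph \<Rightarrow> 'a \<Rightarrow> nat" where
  "degree G v = (\<Sum>e \<in># edges G. count e v)"

definition min_degree :: "'a mgraph \<Rightarrow> nat" where
  "min_degree G = Min (degree G ` verts G)"

definition nbhd :: "'a mgraph \<Rightarrow> 'a \<Rightarrow> 'a set" where
  "nbhd G v = {u. {#v, u#} \<in># edges G}"

definition nbhd_set :: "'a mgraph \<Rightarrow> 'a set \<Rightarrow> 'a set" where
  "nbhd_set G X = (\<Union>x \<in> X. nbhd G x)"

text \<open>The vertices at distance exactly \<open>n\<close> from \<open>v\<close>: some walk of length \<open>n\<close>, none shorter.\<close>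

definition at_distance :: "'a mgraph \<Rightarrow> nat \<Rightarrow> 'a \<Rightarrow> 'a set" where
  "at_distance G n v =
     {u \<in> verts G. (v, u) \<in> adj G ^^ n \<and> (\<forall>k < n. (v, u) \<notin> adj G ^^ k)}"

text \<open>The number of edges, with multiplicity, having one end in \<open>A\<close> and the other in \<open>B\<close>.\<close>

definition edges_between :: "'a mgraph \<Rightarrow> 'a set \<Rightarrow> 'a set \<Rightarrow> nat" where
  "edges_between G A B = size {#e \<in># edges G. \<exists>a \<in> A. \<exists>b \<in> B. e = {#a, b#}#}"

definition two_dominating :: "'a mgraph \<Rightarrow> 'a set \<Rightarrow> bool" where
  "two_dominating G D \<longleftrightarrow> D \<subseteq> verts G \<and>
     (\<forall>v \<in> verts G - D. edges_between G {v} D \<ge> 2)"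

definition dominated22 :: "'a mgraph \<Rightarrow> bool" where
  "dominated22 G \<longleftrightarrow> (\<exists>D D'. D \<subset> verts G \<and> D' \<subset> verts G \<and> D \<inter> D' = {} \<and>
     two_dominating G D \<and> two_dominating G D')"

definition minimal_dominated22 :: "'a mgraph \<Rightarrow> bool" where
  "minimal_dominated22 G \<longleftrightarrow> connected_graph G \<and> dominated22 G \<and>
     (\<forall>E. E \<subset># edges G \<longrightarrow> \<not> dominated22 (G\<lparr>edges := E\<rparr>))"

definition iso :: "'a mgraph \<Rightarrow> 'b mgraph \<Rightarrow> bool" where
  "iso G H \<longleftrightarrow> (\<exists>f. bij_betw f (verts G) (verts H) \<and>
     edges H = image_mset (image_mset f) (edges G))"

text \<open>
  The pair \<open>(e, i)\<close> with \<open>i < count (edges H) e\<close> stands for the \<open>i\<close>-th of the parallel copies of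
  the edge \<open>e\<close>; it is the new vertex inserted into that copy. A vertex inserted into a loop at
  \<open>x\<close> is joined to \<open>x\<close> by two parallel edges, since \<open>x\<close> occurs twice in \<open>e\<close>.
\<close>

definition edge_copies :: "'a mgraph \<Rightarrow> ('a multiset \<times> nat) set" where
  "edge_copies H = (SIGMA e : set_mset (edges H). {..<count (edges H) e})"

definition subdivision :: "'a mgraph \<Rightarrow> ('a + 'a multiset \<times> nat) mgraph" where
  "subdivision H = \<lparr>
     verts = Inl ` verts H \<union> Inr ` edge_copies H,
     edges = (\<Sum>c \<in> edge_copies H. {#{#Inl x, Inr c#}. x \<in># fst c#})\<rparr>"

definition contractible :: "'a mgraph \<Rightarrow> 'a \<Rightarrow> bool" where
  "contractible G v \<longleftrightarrow> bipartite G \<and> v \<in> verts G \<and>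
     (\<forall>u. count (edges G) {#v, u#} \<le> 1)"

text \<open>
  The \<open>P\<close>-contraction, for a contractible vertex \<open>v\<close> of a bipartite graph and a partition \<open>P\<close> of
  its neighbourhood. The edges are those of \<open>G\<close> with no end in \<open>nbhd G v\<close> (these are all the edges
  at vertices outside distance 2 of \<open>v\<close>, and the edges from a vertex \<open>u\<close> at distance 2 to
  \<open>nbhd G u - nbhd G v\<close>), one edge from \<open>v\<close> to every \<open>(v, S)\<close>, and, between \<open>u\<close> at distance 2 and
  \<open>(v, S)\<close>, as many edges as \<open>G\<close> has between \<open>u\<close> and \<open>S\<close>.
\<close>

definition contraction :: "'a mgraph \<Rightarrow> 'a \<Rightarrow> 'a set set \<Rightarrow> ('a + 'a \<times> 'a set) mgraph" where
  "contraction G v P = \<lparr>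
     verts = Inl ` (verts G - nbhd G v) \<union> Inr ` ({v} \<times> P),
     edges =
       {#image_mset Inl e. e \<in># filter_mset (\<lambda>e. set_mset e \<inter> nbhd G v = {}) (edges G)#}
       + (\<Sum>S \<in> P. {#{#Inl v, Inr (v, S)#}#})
       + (\<Sum>u \<in> at_distance G 2 v. \<Sum>S \<in> P.
            replicate_mset (edges_between G {u} S) {#Inl u, Inr (v, S)#})\<rparr>"

text \<open>
  Graphs are considered up to isomorphism. The closure is formed over vertex type \<^typ>\<open>nat\<close>, on
  which every finite graph has an isomorphic copy. A fixed finite vertex type would be too small,
  because contraction decreases the number of vertices.
\<close>

inductive family_nat :: "nat mgraph \<Rightarrow> bool" where
  subdiv: "is_graph H \<Longrightarrow> connected_graph H \<Longrightarrow> min_degree H \<ge> 2 \<Longrightarrow>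
     iso (subdivision (H :: nat mgraph)) G \<Longrightarrow> family_nat G"
| contract: "family_nat G \<Longrightarrow> contractible G v \<Longrightarrow> degree G v \<ge> 3 \<Longrightarrow>
     partition_on (nbhd G v) {S1, S2} \<Longrightarrow> S1 \<noteq> S2 \<Longrightarrow> card S1 = 1 \<Longrightarrow>
     (\<forall>u \<in> nbhd_set G S2 - {v}. degree G u = 2) \<Longrightarrow>
     iso (contraction G v {S1, S2}) G' \<Longrightarrow> family_nat G'"

definition in_family :: "'a mgraph \<Rightarrow> bool" where
  "in_family G \<longleftrightarrow> (\<exists>G'. family_nat G' \<and> iso G' G)"

end

theory Submission imports Defs begin

text \<open>
  A connected graph is minimal (2,2)-dominated iff it is bipartite, all degrees are at least 2 and
  every edge has an end of degree exactly 2: the edges across a dominating pair already suffice,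
  and an edge is superfluous iff both its ends have degree at least 3. Call such graphs lean.

  Subdivision graphs are lean, and the admissible contractions preserve leanness because they
  change degrees only at the centre \<open>v\<close> and its neighbours. Conversely, fix the colour classes
  of a lean graph. If one class has only vertices of degree 2, the graph is the subdivision of a
  graph on the other class. Otherwise connectedness yields a path \<open>s1, v, s2\<close> with
  \<open>s1\<close>, \<open>v\<close> of degree 2 and \<open>s2\<close> of degree at least 3 in a prescribed class;
  splitting \<open>s2\<close> into vertices of degree 2 adjacent to \<open>v\<close> inverts a contraction and lowers
  the number of vertices of degree at least 3 in that class.
\<close>

section \<open>Lean graphs\<close>

text \<open>Splitting \<open>s2\<close> does not destroy a vertex of large degree but trades one for
  another: \<open>s2\<close> disappears and \<open>v\<close> takes over its degree. The two have
  different colours, and this is why the induction counts vertices of degree at least 3 in one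
  colour class only and carries a colouring along.

  The degree conditions all come from one demand, that a vertex of degree at least 3 has only
  neighbours of degree 2. After the splitting \<open>v\<close> is such a vertex, so the neighbour
  \<open>s1\<close>, which stays as it is and forms the block with one element, must already have
  degree 2. After a contraction the merged vertex is one, and the condition on \<open>N(S2)\<close>
  without \<open>v\<close> makes its other neighbours fit.

  If the required path is missing, vertices of degree at least 3 in the counted class alternate with
  vertices of degree 2 all over the connected graph, so the opposite class has degree 2
  throughout.\<close>

lemma pair_mset_eq_iff: "{#a, b#} = {#c, d#} \<longleftrightarrow> a = c \<and> b = d \<or> a = d \<and> b = c"
  by (auto simp: add_eq_conv_ex)

lemma size_2_mset_conv: "size M = 2 \<longleftrightarrow> (\<exists>a b. M = {#a, b#})"
proof
  assume "size M = 2"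
  then obtain a N where "M = add_mset a N" "size N = 1"
    by (metis One_nat_def Suc_1 size_eq_Suc_imp_eq_union size_add_mset add_mset_add_single nat.inject)
  then show "\<exists>a b. M = {#a, b#}" using size_1_singleton_mset by blast
qed auto

text \<open>The degree as a function of the edge multiset alone: it is additive over sums of
  multisets, so a graph written as a sum of stars has its degrees computed summand by
  summand.\<close>

definition mdeg :: "'a multiset multiset \<Rightarrow> 'a \<Rightarrow> nat" where
  "mdeg E v = (\<Sum>e\<in>#E. count e v)"

lemma degree_eq_mdeg: "degree G v = mdeg (edges G) v"
  by (simp add: degree_def mdeg_def)

lemma mdeg_simps [simp]:
  "mdeg {#} v = 0"
  "mdeg (add_mset e E) v = count e v + mdeg E v"
  "mdeg (E + F) v = mdeg E v + mdeg F v"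
  by (simp_all add: mdeg_def)

lemma mdeg_sum [simp]: "mdeg (\<Sum>x\<in>A. F x) v = (\<Sum>x\<in>A. mdeg (F x) v)"
  by (induction A rule: infinite_finite_induct) auto

lemma mdeg_eq_0_iff: "mdeg E v = 0 \<longleftrightarrow> (\<forall>e\<in>#E. v \<notin># e)"
  by (induction E) (auto simp: count_eq_zero_iff)

lemma mdeg_star: "mdeg {#{#y, x#}. y \<in># N#} z = count N z + (if z = x then size N else 0)"
  by (induction N) auto

text \<open>\<open>N\<close> is the multiset of opposite ends; parallel edges at \<open>x\<close>
  become repeated elements, which a set of neighbours would lose.\<close>

lemma star_decomposition:
  assumes "\<forall>e\<in>#E. size e = 2 \<and> x \<in># e"
  shows "\<exists>N. E = {#{#y, x#}. y \<in># N#}"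
  using assms
proof (induction E)
  case empty
  then show ?case by (intro exI[of _ "{#}"]) auto
next
  case (add e E)
  then obtain N where N: "E = {#{#y, x#}. y \<in># N#}" by auto
  from add.prems obtain y where "e = {#y, x#}"
    unfolding size_2_mset_conv by (auto simp: add_mset_commute)
  then show ?case using N by (intro exI[of _ "add_mset y N"]) auto
qed

text \<open>An edge meeting \<open>N\<close> does so in a single vertex and is counted in that
  summand only; an edge missing \<open>N\<close> is counted by the first filter. This rebuilds a
  graph from the stars around vertices of one colour.\<close>

lemma decompose_at_independent:
  assumes "finite N" "\<And>e x y. e \<in># E \<Longrightarrow> x \<in># e \<Longrightarrow> y \<in># e \<Longrightarrow> x \<in> N \<Longrightarrow> y \<in> N \<Longrightarrow> x = y"
  shows "E = filter_mset (\<lambda>e. set_mset e \<inter> N = {}) E + (\<Sum>x\<in>N. filter_mset (\<lambda>e. x \<in># e) E)"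
proof (rule multiset_eqI)
  fix e
  show "count E e = count (filter_mset (\<lambda>e. set_mset e \<inter> N = {}) E +
      (\<Sum>x\<in>N. filter_mset (\<lambda>e. x \<in># e) E)) e"
  proof (cases "e \<in># E \<and> set_mset e \<inter> N \<noteq> {}")
    case True
    then obtain x where x: "x \<in> N" "x \<in># e" by auto
    have "(\<Sum>y\<in>N. if y \<in># e then count E e else 0) = (\<Sum>y\<in>N. if y = x then count E e else 0)"
      using assms(2) x True by (intro sum.cong) auto
    then show ?thesis using True x assms(1) by (auto simp: count_sum)
  next
    case False
    then have "(\<Sum>x\<in>N. count (filter_mset (\<lambda>e. x \<in># e) E) e) = 0"
      by (intro sum.neutral) (auto simp: not_in_iff)
    then show ?thesis using False by (auto simp: count_sum not_in_iff)
  qed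
qed

text \<open>A predicate on the whole type, constrained only by the edges: it passes to smaller
  multisets and to sums, whereas the classes in \<open>bipartite\<close> are tied to a vertex set.
  The inequality also excludes loops.\<close>

definition properly_coloured :: "('a \<Rightarrow> bool) \<Rightarrow> 'a multiset multiset \<Rightarrow> bool" where
  "properly_coloured c E \<longleftrightarrow> (\<forall>e\<in>#E. \<exists>a b. e = {#a, b#} \<and> c a \<noteq> c b)"

lemma properly_coloured_pair:
  "properly_coloured c E \<Longrightarrow> {#a, b#} \<in># E \<Longrightarrow> c a \<noteq> c b"
  unfolding properly_coloured_def by (metis pair_mset_eq_iff)

lemma properly_coloured_simps [simp]:
  "properly_coloured c {#}"
  "properly_coloured c (add_mset e E) \<longleftrightarrow> (\<exists>a b. e = {#a, b#} \<and> c a \<noteq> c b) \<and> properly_coloured c E"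
  "properly_coloured c (E + F) \<longleftrightarrow> properly_coloured c E \<and> properly_coloured c F"
  by (auto simp: properly_coloured_def)

lemma properly_coloured_unique_end:
  assumes "properly_coloured c E" "e \<in># E" "x \<in># e" "y \<in># e" "c x = c y"
  shows "x = y"
proof -
  obtain a b where "e = {#a, b#}" "c a \<noteq> c b"
    using assms(1,2) unfolding properly_coloured_def by blast
  then show ?thesis using assms(3-5) by auto
qed

lemma bipartite_iff_properly_coloured:
  assumes "is_graph G"
  shows "bipartite G \<longleftrightarrow> (\<exists>c. properly_coloured c (edges G))"
proof
  assume "bipartite G"
  then obtain A B where "A \<inter> B = {}" "\<forall>e\<in>#edges G. \<exists>a\<in>A. \<exists>b\<in>B. e = {#a, b#}"
    unfolding bipartite_def by blast
  then have "properly_coloured (\<lambda>x. x \<in> A) (edges G)"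
    unfolding properly_coloured_def by (metis disjoint_iff)
  then show "\<exists>c. properly_coloured c (edges G)" by blast
next
  assume "\<exists>c. properly_coloured c (edges G)"
  then obtain c where c: "properly_coloured c (edges G)" ..
  have "\<exists>a\<in>{x\<in>verts G. c x}. \<exists>b\<in>{x\<in>verts G. \<not> c x}. e = {#a, b#}" if e: "e \<in># edges G" for e
  proof -
    obtain a b where ab: "e = {#a, b#}" "c a \<noteq> c b"
      using c e unfolding properly_coloured_def by blast
    moreover have "a \<in> verts G" "b \<in> verts G" using assms e ab unfolding is_graph_def by auto
    moreover have "e = {#b, a#}" using ab(1) by simp
    ultimately show ?thesis by (cases "c a") blast+
  qed
  then show "bipartite G"
    unfolding bipartite_def
    by (intro exI[of _ "{x\<in>verts G. c x}"] exI[of _ "{x\<in>verts G. \<not> c x}"]) auto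
qed

text \<open>A coloured edge is no loop, so it adds exactly 1 to the degree of each end.\<close>

lemma size_edges_at:
  "properly_coloured c E \<Longrightarrow> size (filter_mset (\<lambda>e. v \<in># e) E) = mdeg E v"
  by (induction E) (auto simp: count_eq_zero_iff split: if_splits)

definition lean :: "'a mgraph \<Rightarrow> bool" where
  "lean G \<longleftrightarrow> is_graph G \<and> connected_graph G \<and> (\<exists>c. properly_coloured c (edges G)) \<and>
     (\<forall>v\<in>verts G. 2 \<le> degree G v) \<and> (\<forall>e\<in>#edges G. \<exists>x\<in>#e. degree G x = 2)"

section \<open>Minimal (2,2)-domination and leanness\<close>

lemma is_graph_edges_subset:
  "is_graph G \<Longrightarrow> E \<subseteq># edges G \<Longrightarrow> is_graph (G\<lparr>edges := E\<rparr>)"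
  unfolding is_graph_def by (auto dest: mset_subset_eqD)

lemma edges_between_le_mdeg:
  "edges_between G {v} D \<le> mdeg (edges G) v"
proof -
  have "size (filter_mset (\<lambda>e. \<exists>a\<in>{v}. \<exists>b\<in>D. e = {#a, b#}) E) \<le> mdeg E v" for E
    by (induction E) auto
  then show ?thesis by (simp add: edges_between_def)
qed

text \<open>A vertex cannot lie in both of the disjoint sets, and a set that misses it sends two
  edges to it.\<close>

lemma dominated22_imp_degree_ge_2:
  assumes "dominated22 G" "v \<in> verts G"
  shows "2 \<le> degree G v"
proof -
  obtain D D' where D: "D \<inter> D' = {}" "two_dominating G D" "two_dominating G D'"
    using assms unfolding dominated22_def by blast
  then have "2 \<le> edges_between G {v} D \<or> 2 \<le> edges_between G {v} D'"
    using assms(2) unfolding two_dominating_def by auto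
  then show ?thesis
    using edges_between_le_mdeg[of G v D] edges_between_le_mdeg[of G v D']
    by (auto simp: degree_eq_mdeg)
qed

text \<open>The colour classes are the dominating pair: all edges at a vertex lead to the opposite
  class, so the number of edges into that class is the full degree.\<close>

lemma properly_coloured_imp_dominated22:
  assumes G: "is_graph G" and ne: "verts G \<noteq> {}" and c: "properly_coloured c (edges G)"
    and deg: "\<And>v. v \<in> verts G \<Longrightarrow> 2 \<le> degree G v"
  shows "dominated22 G"
proof -
  let ?D = "\<lambda>b. {x\<in>verts G. c x = b}"
  have between: "edges_between G {v} (?D b) = degree G v" if "v \<in> verts G" "c v \<noteq> b" for v b
  proof -
    have "filter_mset (\<lambda>e. \<exists>a\<in>{v}. \<exists>w\<in>?D b. e = {#a, w#}) (edges G)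
        = filter_mset (\<lambda>e. v \<in># e) (edges G)"
    proof (rule filter_mset_cong0)
      fix e assume e: "e \<in># edges G"
      then obtain x y where xy: "e = {#x, y#}" "c x \<noteq> c y"
        using c unfolding properly_coloured_def by blast
      moreover have "x \<in> verts G" "y \<in> verts G" using G e xy unfolding is_graph_def by auto
      ultimately show "(\<exists>a\<in>{v}. \<exists>w\<in>?D b. e = {#a, w#}) = (v \<in># e)"
        using that by (auto simp: pair_mset_eq_iff)
    qed
    then show ?thesis
      by (simp only: edges_between_def degree_eq_mdeg size_edges_at[OF c])
  qed
  have dom: "two_dominating G (?D b)" for b
    unfolding two_dominating_def using between deg by auto
  \<comment> \<open>A positive degree provides an edge, whose ends differ in colour, so neither
    class is everything.\<close>
  have psub: "?D b \<subset> verts G" for b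
  proof -
    have False if all: "\<forall>x\<in>verts G. c x = b"
    proof -
      obtain v where v: "v \<in> verts G" using ne by blast
      have "mdeg (edges G) v \<noteq> 0" using deg[OF v] by (simp add: degree_eq_mdeg)
      then obtain e where e: "e \<in># edges G" unfolding mdeg_eq_0_iff by blast
      then obtain x y where xy: "e = {#x, y#}" "c x \<noteq> c y"
        using c unfolding properly_coloured_def by blast
      moreover have "x \<in> verts G" "y \<in> verts G" using G e xy unfolding is_graph_def by auto
      ultimately show False using all by auto
    qed
    then show ?thesis by blast
  qed
  have "?D True \<inter> ?D False = {}" by auto
  with psub[of True] psub[of False] dom[of True] dom[of False] show ?thesis
    unfolding dominated22_def by (intro exI conjI)
qed

theorem minimal_dominated22_iff_lean:
  assumes G: "is_graph G" and conn: "connected_graph G"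
  shows "minimal_dominated22 G \<longleftrightarrow> lean G"
proof
  assume "lean G"
  then obtain c where c: "properly_coloured c (edges G)"
    and deg: "\<And>v. v \<in> verts G \<Longrightarrow> 2 \<le> degree G v"
    and two: "\<And>e. e \<in># edges G \<Longrightarrow> \<exists>x\<in>#e. degree G x = 2"
    unfolding lean_def by blast
  have ne: "verts G \<noteq> {}" using conn by (simp add: connected_graph_def)
  have "\<not> dominated22 (G\<lparr>edges := E\<rparr>)" if E: "E \<subset># edges G" for E
  proof
    assume dom: "dominated22 (G\<lparr>edges := E\<rparr>)"
    \<comment> \<open>A deleted edge has an end \<open>x\<close> of degree 2 in \<open>G\<close>;
      since \<open>F\<close> takes at least one from this degree, at most 1 is left in
      \<open>E\<close>.\<close>
    from E obtain F where F: "edges G = E + F" "F \<noteq> {#}"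
      by (metis subset_mset.less_le subset_mset.add_diff_inverse add_cancel_right_right)
    then obtain e where e: "e \<in># F" by blast
    then obtain x where x: "x \<in># e" "degree G x = 2" using two F by auto
    have "mdeg F x \<noteq> 0" using e x by (auto simp: mdeg_eq_0_iff)
    moreover have "x \<in> verts G" using G F e x unfolding is_graph_def by auto
    then have "2 \<le> mdeg E x"
      using dominated22_imp_degree_ge_2[OF dom, of x] by (simp add: degree_eq_mdeg)
    ultimately show False using x(2) F by (simp add: degree_eq_mdeg)
  qed
  then show "minimal_dominated22 G"
    unfolding minimal_dominated22_def
    using conn properly_coloured_imp_dominated22[OF G ne c deg] by blast
next
  assume min: "minimal_dominated22 G"
  have ne: "verts G \<noteq> {}" using conn by (simp add: connected_graph_def)
  have minE: "E = edges G" if "E \<subseteq># edges G" "dominated22 (G\<lparr>edges := E\<rparr>)" for E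
    using min that unfolding minimal_dominated22_def by (meson subset_mset.le_neq_trans)
  from min have dom: "dominated22 G" unfolding minimal_dominated22_def by blast
  then obtain D D' where D: "D \<inter> D' = {}" "two_dominating G D" "two_dominating G D'"
    unfolding dominated22_def by blast
  let ?c = "\<lambda>x. x \<in> D"
  \<comment> \<open>Only the edges with exactly one end in \<open>D\<close> are kept. Once they are
    seen to suffice for domination, minimality makes them all the edges, and membership in
    \<open>D\<close> is the colouring.\<close>
  define E where "E = filter_mset (\<lambda>e. \<exists>a b. e = {#a, b#} \<and> ?c a \<noteq> ?c b) (edges G)"
  have cE: "properly_coloured ?c E" unfolding properly_coloured_def E_def by auto
  have sub: "E \<subseteq># edges G" unfolding E_def by simp
  have degE: "2 \<le> degree (G\<lparr>edges := E\<rparr>) v" if v: "v \<in> verts G" for v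
  proof -
    \<comment> \<open>\<open>B\<close> is a set of the pair that misses \<open>v\<close>:
      \<open>D'\<close> if \<open>v\<close> lies in \<open>D\<close>, otherwise \<open>D\<close>.
      Every edge from \<open>v\<close> to \<open>B\<close> has one end in \<open>D\<close> and
      survives in \<open>E\<close>.\<close>
    obtain B where B: "2 \<le> edges_between G {v} B" "\<forall>b\<in>B. (v \<in> D) \<noteq> (b \<in> D)"
    proof (cases "v \<in> D")
      case True
      then have "v \<in> verts G - D'" "\<forall>b\<in>D'. (v \<in> D) \<noteq> (b \<in> D)" using D(1) v by auto
      then show ?thesis using D(3) that[of D'] unfolding two_dominating_def by blast
    next
      case False
      then show ?thesis using D(2) v that[of D] unfolding two_dominating_def by blast
    qed
    have "filter_mset (\<lambda>e. \<exists>a\<in>{v}. \<exists>b\<in>B. e = {#a, b#}) E =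
        filter_mset (\<lambda>e. \<exists>a\<in>{v}. \<exists>b\<in>B. e = {#a, b#}) (edges G)"
      unfolding E_def filter_filter_mset using B(2) by (intro filter_mset_cong0) auto
    then have "edges_between (G\<lparr>edges := E\<rparr>) {v} B = edges_between G {v} B"
      by (simp add: edges_between_def)
    then show ?thesis
      using B(1) edges_between_le_mdeg[of "G\<lparr>edges := E\<rparr>" v B] by (simp add: degree_eq_mdeg)
  qed
  have "dominated22 (G\<lparr>edges := E\<rparr>)"
    using properly_coloured_imp_dominated22[OF is_graph_edges_subset[OF G sub], of ?c] ne cE degE
    by simp
  then have c: "properly_coloured ?c (edges G)" using minE[OF sub] cE by simp
  have deg: "2 \<le> degree G v" if "v \<in> verts G" for v
    using dominated22_imp_degree_ge_2[OF dom that] .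
  have "\<exists>x\<in>#e. degree G x = 2" if e: "e \<in># edges G" for e
  proof (rule ccontr)
    assume no: "\<not> (\<exists>x\<in>#e. degree G x = 2)"
    define F where "F = edges G - {#e#}"
    have F: "edges G = add_mset e F" using e by (simp add: F_def)
    \<comment> \<open>Both ends of \<open>e\<close> have degree at least 3 and \<open>e\<close> is
      no loop, so deleting it costs each end exactly 1.\<close>
    have "2 \<le> degree (G\<lparr>edges := F\<rparr>) v" if v: "v \<in> verts G" for v
    proof -
      have "\<exists>a b. e = {#a, b#} \<and> ?c a \<noteq> ?c b" using c e unfolding properly_coloured_def by blast
      then have "count e v \<le> 1" by (auto split: if_splits)
      moreover have "v \<in># e \<Longrightarrow> degree G v \<noteq> 2" using no by auto
      ultimately show ?thesis using deg[OF v] F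
        by (cases "v \<in># e") (auto simp: degree_eq_mdeg not_in_iff)
    qed
    moreover have "properly_coloured ?c F" using c F by simp
    moreover have "is_graph (G\<lparr>edges := F\<rparr>)" by (rule is_graph_edges_subset[OF G]) (simp add: F)
    ultimately have "dominated22 (G\<lparr>edges := F\<rparr>)"
      using properly_coloured_imp_dominated22[of "G\<lparr>edges := F\<rparr>" ?c] ne by simp
    then have "F = edges G" using minE[of F] F by (metis mset_subset_eq_add_right add_mset_add_single union_commute)
    then show False using F by simp
  qed
  then show "lean G" unfolding lean_def using G conn c deg by blast
qed

section \<open>Invariance under isomorphism and subdivision graphs\<close>

lemma adj_sym: "sym (adj G)"
  by (auto simp: sym_def adj_def add_mset_commute)

text \<open>Edges may become walks or shrink to a point, and \<open>h\<close> need not be onto: each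
  vertex of \<open>H\<close> only has to be reachable from an image. This weak form covers
  subdividing, suppressing, merging and splitting alike.\<close>

lemma connected_graph_transfer:
  assumes G: "connected_graph G" and ne: "verts H \<noteq> {}"
    and edge: "\<And>x y. {#x, y#} \<in># edges G \<Longrightarrow> (h x, h y) \<in> (adj H)\<^sup>*"
    and cover: "\<And>z. z \<in> verts H \<Longrightarrow> \<exists>x\<in>verts G. (h x, z) \<in> (adj H)\<^sup>*"
  shows "connected_graph H"
proof -
  have walk: "(h x, h y) \<in> (adj H)\<^sup>*" if "(x, y) \<in> (adj G)\<^sup>*" for x y
    using that
  proof induction
    case (step y z)
    then show ?case using edge[of y z] by (auto simp: adj_def)
  qed auto
  have "(z, w) \<in> (adj H)\<^sup>*" if z: "z \<in> verts H" and w: "w \<in> verts H" for z w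
  proof -
    obtain x y where xy: "x \<in> verts G" "(h x, z) \<in> (adj H)\<^sup>*" "y \<in> verts G" "(h y, w) \<in> (adj H)\<^sup>*"
      using cover z w by meson
    then have "(h x, h y) \<in> (adj H)\<^sup>*" using walk G unfolding connected_graph_def by blast
    moreover have "(z, h x) \<in> (adj H)\<^sup>*" using xy(2) by (meson sym_rtrancl adj_sym symD)
    ultimately show ?thesis using xy(4) by (meson rtrancl_trans)
  qed
  then show ?thesis using ne by (simp add: connected_graph_def)
qed

lemma count_image_mset_inj_on:
  assumes "inj_on f V" "set_mset M \<subseteq> V" "x \<in> V"
  shows "count (image_mset f M) (f x) = count M x"
  using assms(2)
proof (induction M)
  case (add y M)
  then show ?case using assms(1,3) by (auto simp: inj_on_eq_iff)
qed auto

lemma mdeg_image_inj_on: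
  assumes "inj_on f V" "\<And>e. e \<in># E \<Longrightarrow> set_mset e \<subseteq> V" "x \<in> V"
  shows "mdeg (image_mset (image_mset f) E) (f x) = mdeg E x"
  using assms(2)
proof (induction E)
  case (add e E)
  then have "count (image_mset f e) (f x) = count e x"
    using count_image_mset_inj_on[OF assms(1) _ assms(3)] by simp
  then show ?case using add by simp
qed simp

text \<open>The inverse undoes \<open>f\<close> on \<open>verts G\<close> only, and well-formedness
  of \<open>G\<close> keeps the ends of all edges there.\<close>

lemma iso_sym:
  assumes "is_graph G" "iso G H"
  shows "iso H G"
proof -
  obtain f where f: "bij_betw f (verts G) (verts H)" "edges H = image_mset (image_mset f) (edges G)"
    using assms(2) unfolding iso_def by blast
  let ?g = "inv_into (verts G) f"
  have "image_mset (image_mset ?g) (edges H) = image_mset id (edges G)"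
    unfolding f(2) multiset.map_comp
  proof (rule image_mset_cong)
    fix e assume "e \<in># edges G"
    then have sub: "set_mset e \<subseteq> verts G" using assms(1) unfolding is_graph_def by blast
    have "image_mset (?g \<circ> f) e = image_mset id e"
      using sub f(1) by (intro image_mset_cong) (auto simp: bij_betw_def)
    then show "(image_mset ?g \<circ> image_mset f) e = id e" by (simp add: multiset.map_comp)
  qed
  then show ?thesis
    unfolding iso_def using bij_betw_inv_into[OF f(1)] by (intro exI[of _ ?g]) auto
qed

lemma iso_lean:
  assumes "lean G" "iso G H"
  shows "lean H"
proof -
  obtain f where f: "bij_betw f (verts G) (verts H)" "edges H = image_mset (image_mset f) (edges G)"
    using assms(2) unfolding iso_def by blast
  have inj: "inj_on f (verts G)" and im: "f ` verts G = verts H" using f(1) by (auto simp: bij_betw_def)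
  have G: "is_graph G" and conn: "connected_graph G" using assms(1) by (auto simp: lean_def)
  have sub: "set_mset e \<subseteq> verts G" "size e = 2" if "e \<in># edges G" for e
    using G that unfolding is_graph_def by auto
  have deg: "degree H (f x) = degree G x" if "x \<in> verts G" for x
    unfolding degree_eq_mdeg f(2) using mdeg_image_inj_on[OF inj sub(1) that] .
  have "is_graph H"
    using G sub unfolding is_graph_def im[symmetric] f(2) by fastforce
  moreover have "connected_graph H"
  proof (rule connected_graph_transfer[OF conn, where h = f])
    show "verts H \<noteq> {}" using conn im unfolding connected_graph_def by blast
    show "(f x, f y) \<in> (adj H)\<^sup>*" if "{#x, y#} \<in># edges G" for x y
      using that unfolding adj_def f(2) by (intro r_into_rtrancl) force
    show "\<exists>x\<in>verts G. (f x, z) \<in> (adj H)\<^sup>*" if "z \<in> verts H" for z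
      using that im by (metis imageE rtrancl.rtrancl_refl)
  qed
  moreover have "\<exists>c. properly_coloured c (edges H)"
  proof -
    obtain c where c: "properly_coloured c (edges G)" using assms(1) unfolding lean_def by blast
    have "properly_coloured (c \<circ> inv_into (verts G) f) (edges H)"
      unfolding properly_coloured_def
    proof
      fix e assume "e \<in># edges H"
      then obtain e' where e': "e' \<in># edges G" "e = image_mset f e'" unfolding f(2) by auto
      then obtain a b where ab: "e' = {#a, b#}" "c a \<noteq> c b"
        using c unfolding properly_coloured_def by blast
      then have "a \<in> verts G" "b \<in> verts G" using sub(1)[OF e'(1)] by auto
      then show "\<exists>a b. e = {#a, b#} \<and> (c \<circ> inv_into (verts G) f) a \<noteq> (c \<circ> inv_into (verts G) f) b"
        using ab e' inj by (intro exI[of _ "f a"] exI[of _ "f b"]) auto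
    qed
    then show ?thesis by blast
  qed
  moreover have "\<forall>v\<in>verts H. 2 \<le> degree H v"
    using assms(1) deg unfolding lean_def im[symmetric] by simp
  moreover have "\<exists>x\<in>#e. degree H x = 2" if e: "e \<in># edges H" for e
  proof -
    obtain e' where e': "e' \<in># edges G" "e = image_mset f e'" using e unfolding f(2) by auto
    then obtain x where x: "x \<in># e'" "degree G x = 2" using assms(1) unfolding lean_def by blast
    then have "degree H (f x) = 2" using deg[of x] sub(1)[OF e'(1)] by auto
    then show ?thesis using e'(2) x(1) by auto
  qed
  ultimately show ?thesis unfolding lean_def by blast
qed

lemma ex_iso_nat:
  fixes G :: "'a mgraph"
  assumes "is_graph G"
  shows "\<exists>G' :: nat mgraph. iso G G' \<and> iso G' G"
proof -
  obtain f :: "'a \<Rightarrow> nat" where f: "inj_on f (verts G)"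
    using assms finite_imp_inj_to_nat_seg[of "verts G"] unfolding is_graph_def by blast
  let ?G = "\<lparr>verts = f ` verts G, edges = image_mset (image_mset f) (edges G)\<rparr>"
  have "iso G ?G" unfolding iso_def using f by (intro exI[of _ f]) (auto simp: bij_betw_def)
  then show ?thesis using iso_sym[OF assms] by blast
qed

section \<open>Subdivision graphs\<close>

lemma finite_edge_copies [simp]: "finite (edge_copies H)"
  by (simp add: edge_copies_def)

text \<open>Turns sums over inserted vertices into sums over edges with multiplicity, the form in
  which degrees of \<open>H\<close> are given.\<close>

lemma sum_edge_copies:
  fixes F :: "'a multiset \<Rightarrow> 'b :: comm_monoid_add"
  shows "(\<Sum>c\<in>edge_copies H. F (fst c)) = (\<Sum>e\<in>#edges H. F e)"
proof -
  \<comment> \<open>The index set \<open>A\<close> is decoupled from \<open>set_mset E\<close>, so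
    that it stays fixed while the induction adds an edge to \<open>E\<close>.\<close>
  have "(\<Sum>e\<in>A. \<Sum>i<count E e. F e) = (\<Sum>e\<in>#E. F e)" if "finite A" "set_mset E \<subseteq> A" for A E
    using that(2)
  proof (induction E)
    case (add e0 E)
    have "(\<Sum>e\<in>A. \<Sum>i<count (add_mset e0 E) e. F e)
        = (\<Sum>e\<in>A. (\<Sum>i<count E e. F e) + (if e = e0 then F e0 else 0))"
      by (intro sum.cong) auto
    then show ?case using add that(1) by (simp add: sum.distrib add.commute)
  qed auto
  from this[of "set_mset (edges H)" "edges H"] show ?thesis
    unfolding edge_copies_def by (simp add: sum.Sigma split_def)
qed

lemma mdeg_subdivided_edge:
  "mdeg {#{#Inl x, Inr c#}. x \<in># N#} (Inl y) = count N y"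
  "mdeg {#{#Inl x, Inr c#}. x \<in># N#} (Inr d) = (if d = c then size N else 0)"
  by (induction N) auto

lemma edge_of_copy: "c \<in> edge_copies H \<Longrightarrow> fst c \<in># edges H"
  by (auto simp: edge_copies_def)

lemma copy_of_edge: "e \<in># edges H \<Longrightarrow> (e, 0) \<in> edge_copies H"
  by (auto simp: edge_copies_def)

lemma degree_subdivision_Inl: "degree (subdivision H) (Inl x) = degree H x"
  using sum_edge_copies[of "\<lambda>e. count e x" H]
  by (simp add: degree_eq_mdeg subdivision_def mdeg_subdivided_edge mdeg_def[of "edges H"])

lemma degree_subdivision_Inr:
  assumes "is_graph H" "c \<in> edge_copies H"
  shows "degree (subdivision H) (Inr c) = 2"
proof -
  have "size (fst c) = 2" using assms(1) edge_of_copy[OF assms(2)] unfolding is_graph_def by blast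
  then show ?thesis
    using assms(2) by (simp add: degree_eq_mdeg subdivision_def mdeg_subdivided_edge)
qed

lemma mem_edges_subdivision:
  "e \<in># edges (subdivision H) \<longleftrightarrow> (\<exists>c\<in>edge_copies H. \<exists>x\<in>#fst c. e = {#Inl x, Inr c#})"
  by (auto simp: subdivision_def set_mset_sum)

text \<open>Each edge has an inserted vertex as one end, and inserted vertices have degree 2;
  original against inserted vertices is the colouring.\<close>

lemma subdivision_lean:
  assumes H: "is_graph H" and conn: "connected_graph H" and min: "2 \<le> min_degree H"
  shows "lean (subdivision H)"
proof -
  have sub: "set_mset e \<subseteq> verts H" "size e = 2" if "e \<in># edges H" for e
    using H that unfolding is_graph_def by auto
  have V: "verts (subdivision H) = Inl ` verts H \<union> Inr ` edge_copies H"
    by (simp add: subdivision_def)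
  have graph: "is_graph (subdivision H)"
    unfolding is_graph_def
  proof (intro conjI ballI)
    show "finite (verts (subdivision H))" using H by (simp add: V is_graph_def)
    fix e assume "e \<in># edges (subdivision H)"
    then obtain c x where c: "c \<in> edge_copies H" "x \<in># fst c" "e = {#Inl x, Inr c#}"
      unfolding mem_edges_subdivision by blast
    then have "x \<in> verts H" using sub(1)[OF edge_of_copy] by blast
    then show "size e = 2" "set_mset e \<subseteq> verts (subdivision H)" using c by (auto simp: V)
  qed
  have step: "(Inl x, Inr c) \<in> adj (subdivision H)" if "c \<in> edge_copies H" "x \<in># fst c" for x c
    using that by (auto simp: adj_def mem_edges_subdivision)
  have "connected_graph (subdivision H)"
  proof (rule connected_graph_transfer[OF conn, where h = Inl])
    show "verts (subdivision H) \<noteq> {}" using conn by (auto simp: V connected_graph_def)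
    show "(Inl x, Inl y) \<in> (adj (subdivision H))\<^sup>*" if "{#x, y#} \<in># edges H" for x y
    proof -
      have "(Inl x, Inr ({#x, y#}, 0)) \<in> adj (subdivision H)"
        using step[OF copy_of_edge[OF that], of x] by simp
      moreover have "(Inr ({#x, y#}, 0), Inl y) \<in> adj (subdivision H)"
        using step[OF copy_of_edge[OF that], of y] by (simp add: symD[OF adj_sym])
      ultimately show ?thesis by (meson r_into_rtrancl rtrancl_trans)
    qed
    show "\<exists>x\<in>verts H. (Inl x, z) \<in> (adj (subdivision H))\<^sup>*" if z: "z \<in> verts (subdivision H)" for z
    proof (cases z)
      case (Inl x)
      then show ?thesis using z by (auto simp: V)
    next
      case (Inr c)
      then have c: "c \<in> edge_copies H" using z by (auto simp: V)
      then obtain x where "x \<in># fst c"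
        using sub(2)[OF edge_of_copy] by (metis multiset_nonemptyE size_empty zero_neq_numeral)
      then show ?thesis using step[OF c] sub(1)[OF edge_of_copy[OF c]] Inr by blast
    qed
  qed
  moreover have "properly_coloured isl (edges (subdivision H))"
    unfolding properly_coloured_def
  proof
    fix e assume "e \<in># edges (subdivision H)"
    then obtain c x where "e = {#Inl x, Inr c#}" unfolding mem_edges_subdivision by blast
    then show "\<exists>a b. e = {#a, b#} \<and> isl a \<noteq> isl b"
      by (intro exI[of _ "Inl x"] exI[of _ "Inr c"]) simp
  qed
  moreover have "2 \<le> degree H x" if "x \<in> verts H" for x
  proof -
    have "min_degree H \<le> degree H x"
      using H that unfolding min_degree_def is_graph_def by (intro Min_le) auto
    then show ?thesis using min by simp
  qed
  then have "\<forall>v\<in>verts (subdivision H). 2 \<le> degree (subdivision H) v"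
    using degree_subdivision_Inr[OF H] by (auto simp: V degree_subdivision_Inl)
  moreover have "\<forall>e\<in>#edges (subdivision H). \<exists>x\<in>#e. degree (subdivision H) x = 2"
    using degree_subdivision_Inr[OF H] by (auto simp: mem_edges_subdivision)
  ultimately show ?thesis using graph unfolding lean_def by blast
qed

text \<open>An edge \<open>e\<close> has as many copies as \<open>A\<close> has elements mapped to
  \<open>e\<close>; bijections chosen fibre by fibre glue together. This lets the elements of
  \<open>A\<close> act as the inserted vertices.\<close>

lemma ex_indexing_edge_copies:
  assumes A: "finite A" and E: "edges H = image_mset N (mset_set A)"
  shows "\<exists>g. bij_betw g (edge_copies H) A \<and> (\<forall>c\<in>edge_copies H. N (g c) = fst c)"
proof -
  have fin: "finite {a\<in>A. N a = e}" for e using A by simp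
  have card: "count (edges H) e = card {a\<in>A. N a = e}" for e
  proof -
    have "count (image_mset N (mset_set A)) e = card {a\<in>A. N a = e}" using A
    proof induction
      case (insert x F)
      have "{a \<in> insert x F. N a = e} =
          (if N x = e then insert x {a\<in>F. N a = e} else {a\<in>F. N a = e})" by auto
      then show ?case using insert by auto
    qed auto
    then show ?thesis by (simp add: E)
  qed
  have "\<exists>b. bij_betw b {..<count (edges H) e} {a\<in>A. N a = e}" for e
    unfolding card using ex_bij_betw_nat_finite[OF fin] by (metis atLeast0LessThan)
  then obtain b where b: "\<And>e. bij_betw (b e) {..<count (edges H) e} {a\<in>A. N a = e}"
    by metis
  let ?g = "\<lambda>(e, i). b e i"
  have gN: "?g c \<in> A \<and> N (?g c) = fst c" if "c \<in> edge_copies H" for c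
  proof -
    have "b (fst c) (snd c) \<in> {a\<in>A. N a = fst c}"
      using that by (intro bij_betw_apply[OF b]) (auto simp: edge_copies_def)
    then show ?thesis by (simp add: split_def)
  qed
  have inj: "inj_on ?g (edge_copies H)"
  proof (rule inj_onI)
    fix c d assume c: "c \<in> edge_copies H" and d: "d \<in> edge_copies H" and eq: "?g c = ?g d"
    have fst: "fst c = fst d" using gN[OF c] gN[OF d] eq by simp
    have "snd c \<in> {..<count (edges H) (fst c)}" "snd d \<in> {..<count (edges H) (fst d)}"
      using c d by (auto simp: edge_copies_def)
    moreover have "b (fst c) (snd c) = b (fst c) (snd d)" using eq fst by (simp add: split_def)
    ultimately have "snd c = snd d"
      using inj_onD[OF bij_betw_imp_inj_on[OF b[of "fst c"]]] fst by simp
    then show "c = d" using fst by (simp add: prod_eqI)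
  qed
  have "A \<subseteq> ?g ` edge_copies H"
  proof
    fix a assume a: "a \<in> A"
    then have "a \<in> b (N a) ` {..<count (edges H) (N a)}"
      using bij_betw_imp_surj_on[OF b[of "N a"]] by auto
    then obtain i where i: "i < count (edges H) (N a)" "b (N a) i = a" by auto
    then have "(N a, i) \<in> edge_copies H"
      by (auto simp: edge_copies_def simp flip: count_greater_zero_iff)
    then show "a \<in> ?g ` edge_copies H" using i by force
  qed
  then have "bij_betw ?g (edge_copies H) A" using inj gN unfolding bij_betw_def by blast
  then show ?thesis using gN by blast
qed

lemma image_mset_sum: "image_mset f (\<Sum>x\<in>A. F x) = (\<Sum>x\<in>A. image_mset f (F x))"
  by (induction A rule: infinite_finite_induct) auto

text \<open>Every vertex \<open>a\<close> of colour \<open>True\<close> is suppressed: the opposite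
  ends of its two edges form the multiset \<open>N a\<close>, which becomes an edge of
  \<open>H\<close>, and a loop if the two edges are parallel.\<close>

lemma lean_imp_iso_subdivision:
  fixes G :: "'a mgraph"
  assumes G: "lean G" and c: "properly_coloured c (edges G)"
    and two: "\<And>a. a \<in> verts G \<Longrightarrow> c a \<Longrightarrow> degree G a = 2"
  shows "\<exists>H :: 'a mgraph. is_graph H \<and> connected_graph H \<and> 2 \<le> min_degree H \<and> iso (subdivision H) G"
proof -
  have graph: "is_graph G" and conn: "connected_graph G" using G by (auto simp: lean_def)
  have fin: "finite (verts G)" and sub: "\<And>e. e \<in># edges G \<Longrightarrow> size e = 2 \<and> set_mset e \<subseteq> verts G"
    using graph unfolding is_graph_def by auto
  define A where "A = {x\<in>verts G. c x}"
  define B where "B = {x\<in>verts G. \<not> c x}"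
  have finA: "finite A" using fin by (simp add: A_def)
  have "\<exists>N. filter_mset (\<lambda>e. a \<in># e) (edges G) = {#{#y, a#}. y \<in># N#}" for a
    using sub by (intro star_decomposition) auto
  then obtain N where N: "\<And>a. filter_mset (\<lambda>e. a \<in># e) (edges G) = {#{#y, a#}. y \<in># N a#}"
    by metis
  have sizeN: "size (N a) = 2" if "a \<in> A" for a
    using size_edges_at[OF c, of a] two[of a] that by (simp add: N A_def degree_eq_mdeg)
  have memN: "b \<in># N a \<longleftrightarrow> {#b, a#} \<in># edges G" for a b
  proof
    assume "b \<in># N a"
    then have "{#b, a#} \<in># filter_mset (\<lambda>e. a \<in># e) (edges G)" unfolding N by auto
    then show "{#b, a#} \<in># edges G" by simp
  next
    assume "{#b, a#} \<in># edges G"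
    then have "{#b, a#} \<in># {#{#y, a#}. y \<in># N a#}" by (simp flip: N)
    then show "b \<in># N a" by (auto simp: pair_mset_eq_iff)
  qed
  have NB: "b \<in> B" if "b \<in># N a" "a \<in> A" for a b
    using that sub[of "{#b, a#}"] properly_coloured_pair[OF c, of b a]
    by (auto simp: memN A_def B_def)
  \<comment> \<open>Every edge has an end in \<open>A\<close>, so nothing remains besides the stars
    around \<open>A\<close>.\<close>
  have none: "filter_mset (\<lambda>e. set_mset e \<inter> A = {}) (edges G) = filter_mset (\<lambda>_. False) (edges G)"
  proof (rule filter_mset_cong0)
    fix e assume e: "e \<in># edges G"
    then obtain a b where ab: "e = {#a, b#}" "c a \<noteq> c b"
      using c unfolding properly_coloured_def by blast
    then show "(set_mset e \<inter> A = {}) = False" using sub[OF e] by (auto simp: A_def)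
  qed
  have "edges G = filter_mset (\<lambda>e. set_mset e \<inter> A = {}) (edges G)
      + (\<Sum>a\<in>A. filter_mset (\<lambda>e. a \<in># e) (edges G))"
    by (rule decompose_at_independent[OF finA])
      (auto simp: A_def dest: properly_coloured_unique_end[OF c])
  then have EG: "edges G = (\<Sum>a\<in>A. {#{#y, a#}. y \<in># N a#})"
    unfolding none N filter_mset_False add_0 .
  define H where "H = \<lparr>verts = B, edges = image_mset N (mset_set A)\<rparr>"
  have graphH: "is_graph H"
    using fin finA NB sizeN unfolding is_graph_def H_def by (auto simp: B_def)
  have degH: "degree H b = degree G b" if "b \<in> B" for b
  proof -
    have "degree H b = (\<Sum>a\<in>A. count (N a) b)"
      by (simp add: degree_def H_def multiset.map_comp o_def sum_unfold_sum_mset)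
    also have "\<dots> = (\<Sum>a\<in>A. mdeg {#{#y, a#}. y \<in># N a#} b)"
      using that by (intro sum.cong) (auto simp: mdeg_star A_def B_def)
    finally show ?thesis by (simp add: degree_eq_mdeg EG)
  qed
  \<comment> \<open>\<open>h\<close> pushes each suppressed vertex to one of its neighbours and
    fixes \<open>B\<close>, so that connectedness descends to \<open>H\<close>.\<close>
  define h where "h x = (if c x then SOME y. y \<in># N x else x)" for x
  have h: "h a \<in># N a" if "a \<in> A" for a
  proof -
    have "\<exists>y. y \<in># N a" using sizeN[OF that] by (metis multiset_nonemptyE size_empty zero_neq_numeral)
    then show ?thesis using that by (auto simp: h_def A_def intro: someI_ex)
  qed
  have hB: "h x \<in> B" if "x \<in> verts G" for x
    using that h[of x] NB[of "h x" x] by (cases "c x") (auto simp: A_def B_def h_def)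
  have connH: "connected_graph H"
  proof (rule connected_graph_transfer[OF conn, where h = h])
    show "verts H \<noteq> {}" using conn hB by (auto simp: H_def connected_graph_def)
    show "\<exists>x\<in>verts G. (h x, z) \<in> (adj H)\<^sup>*" if "z \<in> verts H" for z
      using that by (intro bexI[of _ z]) (auto simp: H_def B_def h_def)
    \<comment> \<open>The edge \<open>N a\<close> of \<open>H\<close> contains both \<open>b\<close>
      and \<open>h a\<close>, so these coincide or are its two ends.\<close>
    have key: "(b, h a) \<in> (adj H)\<^sup>*" if e: "{#b, a#} \<in># edges G" and a: "c a" for a b
    proof -
      have "a \<in> A" using sub[OF e] a by (auto simp: A_def)
      moreover have "b \<in># N a" using e by (simp add: memN)
      ultimately have "b = h a \<or> N a = {#b, h a#}"
        using sizeN[of a] h[of a] unfolding size_2_mset_conv by fastforce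
      moreover have "N a \<in># edges H" using \<open>a \<in> A\<close> finA by (auto simp: H_def)
      ultimately show ?thesis by (auto simp: adj_def)
    qed
    show "(h x, h y) \<in> (adj H)\<^sup>*" if e: "{#x, y#} \<in># edges G" for x y
    proof (cases "c y")
      case True
      then have "h x = x" using properly_coloured_pair[OF c e] by (simp add: h_def)
      then show ?thesis using key[OF e True] by simp
    next
      case False
      then have "c x" "h y = y" using properly_coloured_pair[OF c e] by (auto simp: h_def)
      moreover have "{#y, x#} \<in># edges G" using e by (simp add: add_mset_commute)
      ultimately have "(h y, h x) \<in> (adj H)\<^sup>*" using key[of y x] by simp
      then show ?thesis by (meson sym_rtrancl adj_sym symD)
    qed
  qed
  have "2 \<le> min_degree H"
  proof -
    \<comment> \<open>\<open>min_degree\<close> is a \<open>Min\<close>, so its index set must be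
      seen to be nonempty.\<close>
    have "B \<noteq> {}" using conn hB by (auto simp: connected_graph_def)
    moreover have "2 \<le> degree H b" if "b \<in> B" for b
      using G degH[OF that] that by (auto simp: lean_def B_def)
    moreover have "finite B" using fin by (simp add: B_def)
    ultimately show ?thesis by (simp add: min_degree_def H_def)
  qed
  moreover have "iso (subdivision H) G"
  proof -
    obtain g where g: "bij_betw g (edge_copies H) A" "\<And>c. c \<in> edge_copies H \<Longrightarrow> N (g c) = fst c"
      using ex_indexing_edge_copies[OF finA, of H N] by (auto simp: H_def)
    \<comment> \<open>Vertices of \<open>B\<close> are kept, and each inserted vertex goes to the
      element of \<open>A\<close> that \<open>g\<close> assigns to its edge copy.\<close>
    let ?f = "case_sum id g"
    have inj: "inj_on g (edge_copies H)" and im: "g ` edge_copies H = A"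
      using g(1) by (auto simp: bij_betw_def)
    have V: "verts (subdivision H) = Inl ` B \<union> Inr ` edge_copies H"
      by (simp add: subdivision_def H_def)
    have "B \<inter> g ` edge_copies H = {}" unfolding im by (auto simp: A_def B_def)
    then have "inj_on ?f (verts (subdivision H))"
      using inj unfolding V by (intro inj_on_Un[THEN iffD2]) (auto simp: inj_on_def)
    moreover have "B \<union> A = verts G" by (auto simp: A_def B_def)
    then have "?f ` verts (subdivision H) = verts G"
      unfolding V image_Un image_image by (simp add: im)
    moreover have "edges G = image_mset (image_mset ?f) (edges (subdivision H))"
    proof -
      have "image_mset (image_mset ?f) (edges (subdivision H)) =
          (\<Sum>c\<in>edge_copies H. {#{#y, g c#}. y \<in># N (g c)#})"
        using g(2) by (simp add: subdivision_def image_mset_sum multiset.map_comp o_def)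
      also have "\<dots> = edges G"
        unfolding EG using sum.reindex_bij_betw[OF g(1), of "\<lambda>a. {#{#y, a#}. y \<in># N a#}"] .
      finally show ?thesis by simp
    qed
    ultimately show ?thesis unfolding iso_def bij_betw_def by blast
  qed
  ultimately show ?thesis using graphH connH by blast
qed

section \<open>Contraction as a local operation\<close>

text \<open>
  The graph \<open>narrow\<close> is the contraction of \<open>wide\<close> at \<open>v\<close> for the partition \<open>{{s1}, X}\<close>, with
  \<open>s1\<close> and \<open>s2\<close> in the roles of \<open>(v, {s1})\<close> and \<open>(v, X)\<close>, so that both graphs live on the same
  vertex type. The second neighbour of \<open>x \<in> insert s1 X\<close> is \<open>\<phi> x\<close>; the multiset \<open>R\<close> holds the
  edges common to both graphs.
\<close>

locale split_pair =
  fixes W :: "'a set" and R v s1 s2 X \<phi>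
  assumes finW: "finite W" and vW: "v \<in> W"
    and R: "\<And>e. e \<in># R \<Longrightarrow> size e = 2 \<and> set_mset e \<subseteq> W - {v}"
    and s1W: "s1 \<notin> W" and s2W: "s2 \<notin> W" and s12: "s1 \<noteq> s2"
    and finX: "finite X" and XW: "X \<inter> W = {}" and s1X: "s1 \<notin> X" and cardX: "2 \<le> card X"
    and \<phi>: "\<And>x. x \<in> insert s1 X \<Longrightarrow> \<phi> x \<in> W - {v}"
begin

abbreviation "N \<equiv> insert s1 X"

definition "wide = \<lparr>verts = W \<union> N, edges = R + (\<Sum>x\<in>N. {#{#v, x#}, {#x, \<phi> x#}#})\<rparr>"

text \<open>Values of \<open>\<phi>\<close> on \<open>X\<close> may repeat; the sum then yields
  parallel edges at \<open>s2\<close>, which correspond to edges with different ends in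
  \<open>wide\<close>.\<close>

definition "narrow = \<lparr>verts = W \<union> {s1, s2},
  edges = R + {#{#v, s1#}, {#v, s2#}, {#s1, \<phi> s1#}#} + (\<Sum>x\<in>X. {#{#s2, \<phi> x#}#})\<rparr>"

lemma finN [simp]: "finite N" using finX by simp

lemma notin_W: "x \<in> N \<Longrightarrow> x \<notin> W" using XW s1W by auto

lemma mem_edges_wide:
  "e \<in># edges wide \<longleftrightarrow> e \<in># R \<or> (\<exists>x\<in>N. e = {#v, x#} \<or> e = {#x, \<phi> x#})"
  unfolding wide_def by (simp only: mgraph.simps set_mset_union set_mset_sum[OF finN]) auto

lemma mem_edges_narrow:
  "e \<in># edges narrow \<longleftrightarrow> e \<in># R \<or> e \<in> {{#v, s1#}, {#v, s2#}, {#s1, \<phi> s1#}} \<or> (\<exists>x\<in>X. e = {#s2, \<phi> x#})"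
  unfolding narrow_def using finX by (auto simp: set_mset_sum)

lemma is_graph_wide: "is_graph wide"
  unfolding is_graph_def
proof (intro conjI ballI)
  show "finite (verts wide)" using finW finX by (simp add: wide_def)
  fix e assume "e \<in># edges wide"
  then show "size e = 2" "set_mset e \<subseteq> verts wide"
    unfolding mem_edges_wide using R vW \<phi> by (auto simp: wide_def)
qed

lemma is_graph_narrow: "is_graph narrow"
  unfolding is_graph_def
proof (intro conjI ballI)
  show "finite (verts narrow)" using finW by (simp add: narrow_def)
  fix e assume "e \<in># edges narrow"
  then show "size e = 2" "set_mset e \<subseteq> verts narrow"
    unfolding mem_edges_narrow using R vW \<phi> by (auto simp: narrow_def)
qed

section \<open>Degrees, connectedness and colourings of the two graphs\<close>

lemma mdeg_R: "y \<notin> W - {v} \<Longrightarrow> mdeg R y = 0"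
  unfolding mdeg_eq_0_iff using R by blast

text \<open>Each \<open>x\<close> in \<open>N\<close> gives 1 to \<open>v\<close>, 2 to itself and 1
  to \<open>\<phi> x\<close>. The last term recurs unchanged in the formula for
  \<open>narrow\<close>.\<close>

lemma degree_wide:
  "degree wide y = mdeg R y + (if y = v then card N else 0) + (if y \<in> N then 2 else 0)
     + card {x\<in>N. \<phi> x = y}"
proof -
  have "(\<Sum>x\<in>N. mdeg {#{#v, x#}, {#x, \<phi> x#}#} y) =
      (\<Sum>x\<in>N. (if y = v then 1 else 0) + (if x = y then 2 else 0) + (if \<phi> x = y then 1 else 0))"
    by (intro sum.cong) auto
  also have "\<dots> = (if y = v then card N else 0) + (if y \<in> N then 2 else 0) + card {x\<in>N. \<phi> x = y}"
    unfolding sum.distrib sum.delta[OF finN]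
    using sum.inter_filter[OF finN, of "\<lambda>_. 1::nat" "\<lambda>x. \<phi> x = y"]
    by (simp del: sum.insert card_insert_disjoint insert_iff)
  finally show ?thesis unfolding degree_eq_mdeg wide_def by (simp del: sum.insert)
qed

lemma degree_narrow:
  "degree narrow y = mdeg R y + (if y = v then 2 else 0) + (if y = s1 then 2 else 0)
     + (if y = s2 then Suc (card X) else 0) + card {x\<in>N. \<phi> x = y}"
proof -
  have "(\<Sum>x\<in>X. mdeg {#{#s2, \<phi> x#}#} y) =
      (\<Sum>x\<in>X. (if y = s2 then 1 else 0) + (if \<phi> x = y then 1 else 0))"
    by (intro sum.cong) auto
  also have "\<dots> = (if y = s2 then card X else 0) + card {x\<in>X. \<phi> x = y}"
    unfolding sum.distrib using sum.inter_filter[OF finX, of "\<lambda>_. 1::nat" "\<lambda>x. \<phi> x = y"] by simp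
  moreover have "card {x\<in>N. \<phi> x = y} = (if \<phi> s1 = y then 1 else 0) + card {x\<in>X. \<phi> x = y}"
  proof -
    have "{x\<in>N. \<phi> x = y} = (if \<phi> s1 = y then insert s1 {x\<in>X. \<phi> x = y} else {x\<in>X. \<phi> x = y})"
      by auto
    then show ?thesis using finX s1X by simp
  qed
  ultimately show ?thesis unfolding degree_eq_mdeg narrow_def by auto
qed

lemma no_preimage: "y \<notin> W - {v} \<Longrightarrow> card {x\<in>N. \<phi> x = y} = 0"
  using \<phi> by (metis (mono_tags, lifting) card.empty empty_Collect_eq)

lemma degree_wide_N: "x \<in> N \<Longrightarrow> degree wide x = 2"
  using notin_W[of x] vW mdeg_R[of x] no_preimage[of x] unfolding degree_wide by auto

lemma degree_wide_v: "degree wide v = Suc (card X)"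
  using notin_W[of v] vW mdeg_R[of v] no_preimage[of v] finX s1X unfolding degree_wide by auto

lemma degree_narrow_v: "degree narrow v = 2"
  using notin_W[of v] vW s1W s2W mdeg_R[of v] no_preimage[of v] unfolding degree_narrow by auto

lemma degree_narrow_s1: "degree narrow s1 = 2"
  using vW s1W s12 mdeg_R[of s1] no_preimage[of s1] unfolding degree_narrow by auto

lemma degree_narrow_s2: "degree narrow s2 = Suc (card X)"
  using vW s2W s12 mdeg_R[of s2] no_preimage[of s2] unfolding degree_narrow by auto

text \<open>The terms for \<open>v\<close>, \<open>s1\<close>, \<open>s2\<close> and
  \<open>N\<close> vanish here, and what is left is common to both formulas.\<close>

lemma degree_wide_eq_narrow: "y \<in> W - {v} \<Longrightarrow> degree wide y = degree narrow y"
  using notin_W[of y] s1W s2W unfolding degree_wide degree_narrow by auto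

text \<open>Collapsing \<open>X\<close> onto \<open>s2\<close> sends every edge of
  \<open>wide\<close> to an edge of \<open>narrow\<close>.\<close>

lemma connected_narrow:
  assumes "connected_graph wide"
  shows "connected_graph narrow"
proof (rule connected_graph_transfer[OF assms, where h = "\<lambda>x. if x \<in> X then s2 else x"])
  let ?h = "\<lambda>x. if x \<in> X then s2 else x"
  show "verts narrow \<noteq> {}" by (simp add: narrow_def)
  have W: "?h x = x" if "x \<in> W" for x using that XW by auto
  show "(?h x, ?h y) \<in> (adj narrow)\<^sup>*" if xy: "{#x, y#} \<in># edges wide" for x y
  proof -
    have "{#?h x, ?h y#} = image_mset ?h {#x, y#}" by simp
    moreover have "image_mset ?h e \<in># edges narrow" if "e \<in># edges wide" for e
      using that unfolding mem_edges_wide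
    proof (elim disjE bexE)
      assume e: "e \<in># R"
      then have "image_mset ?h e = image_mset id e" using R[OF e] XW by (intro image_mset_cong) auto
      then show ?thesis using e by (simp add: mem_edges_narrow)
    next
      fix x assume "x \<in> N" "e = {#v, x#}"
      then show ?thesis using W[OF vW] s1X by (auto simp: mem_edges_narrow)
    next
      fix x assume "x \<in> N" "e = {#x, \<phi> x#}"
      then show ?thesis using W[of "\<phi> x"] \<phi>[of x] s1X by (auto simp: mem_edges_narrow)
    qed
    ultimately show ?thesis using xy by (metis (no_types, lifting) adj_def case_prodI mem_Collect_eq r_into_rtrancl)
  qed
  \<comment> \<open>\<open>s2\<close> is reached as the image of an element of \<open>X\<close>,
    which \<open>cardX\<close> provides.\<close>
  obtain x0 where "x0 \<in> X" using cardX by fastforce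
  then show "\<exists>x\<in>verts wide. (?h x, z) \<in> (adj narrow)\<^sup>*" if z: "z \<in> verts narrow" for z
  proof (cases "z = s2")
    case True
    then show ?thesis using \<open>x0 \<in> X\<close> by (intro bexI[of _ x0]) (auto simp: wide_def)
  next
    case False
    then have "z \<in> verts wide" "z \<notin> X" using z s1X XW by (auto simp: narrow_def wide_def)
    then show ?thesis by (intro bexI[of _ z]) auto
  qed
qed

text \<open>With \<open>s2\<close> sent to \<open>v\<close>, the edge from \<open>v\<close> to
  \<open>s2\<close> shrinks to a point, and an edge from \<open>s2\<close> to
  \<open>\<phi> x\<close> is stretched to the walk \<open>v\<close>, \<open>x\<close>,
  \<open>\<phi> x\<close>.\<close>

lemma connected_wide:
  assumes "connected_graph narrow"
  shows "connected_graph wide"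
proof (rule connected_graph_transfer[OF assms, where h = "\<lambda>x. if x = s2 then v else x"])
  let ?h = "\<lambda>x. if x = s2 then v else x"
  show "verts wide \<noteq> {}" by (simp add: wide_def)
  have W: "?h x = x" if "x \<in> W" for x using that s2W by auto
  have vx: "(v, x) \<in> adj wide" and x\<phi>: "(x, \<phi> x) \<in> adj wide" if "x \<in> N" for x
    using that by (auto simp: adj_def mem_edges_wide)
  have v\<phi>: "(v, \<phi> x) \<in> (adj wide)\<^sup>*" if "x \<in> N" for x
    using vx[OF that] x\<phi>[OF that] by (meson r_into_rtrancl rtrancl_trans)
  show "(?h x, ?h y) \<in> (adj wide)\<^sup>*" if xy: "{#x, y#} \<in># edges narrow" for x y
  proof -
    have sym: "(a, b) \<in> (adj wide)\<^sup>* \<longleftrightarrow> (b, a) \<in> (adj wide)\<^sup>*" for a b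
      by (meson sym_rtrancl adj_sym symD)
    have pair: ?thesis if "{#x, y#} = {#a, b#}" "(?h a, ?h b) \<in> (adj wide)\<^sup>*" for a b
      using that sym unfolding pair_mset_eq_iff by blast
    from xy show ?thesis unfolding mem_edges_narrow
    proof (elim disjE insertE bexE emptyE)
      assume e: "{#x, y#} \<in># R"
      then have "(x, y) \<in> adj wide" by (simp add: adj_def mem_edges_wide)
      moreover have "x \<in> W" "y \<in> W" using R[OF e] by auto
      ultimately show ?thesis using W by auto
    next
      assume "{#x, y#} = {#v, s1#}"
      then show ?thesis by (rule pair) (use W[OF vW] vx[of s1] s12 in auto)
    next
      assume "{#x, y#} = {#v, s2#}"
      then show ?thesis by (rule pair) auto
    next
      assume "{#x, y#} = {#s1, \<phi> s1#}"
      then show ?thesis by (rule pair) (use W[of "\<phi> s1"] \<phi>[of s1] x\<phi>[of s1] s12 in auto)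
    next
      fix z assume "z \<in> X" "{#x, y#} = {#s2, \<phi> z#}"
      then show ?thesis by (intro pair[of s2 "\<phi> z"]) (use W[of "\<phi> z"] \<phi>[of z] v\<phi>[of z] in auto)
    qed
  qed
  show "\<exists>x\<in>verts narrow. (?h x, z) \<in> (adj wide)\<^sup>*" if z: "z \<in> verts wide" for z
  proof (cases "z \<in> W")
    case True
    then show ?thesis using W by (intro bexI[of _ z]) (auto simp: narrow_def)
  next
    case False
    then have "z \<in> N" using z by (auto simp: wide_def)
    then show ?thesis using vx[of z] W[OF vW] vW by (intro bexI[of _ v]) (auto simp: narrow_def)
  qed
qed

text \<open>All of \<open>N\<close> is adjacent to \<open>v\<close> and so has the colour of
  \<open>s1\<close>; the merged vertex takes it.\<close>

lemma coloured_narrow: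
  assumes c: "properly_coloured c (edges wide)"
  shows "properly_coloured (c(s2 := c s1)) (edges narrow)"
proof -
  have vx: "c v \<noteq> c x" and x\<phi>: "c x \<noteq> c (\<phi> x)" if "x \<in> N" for x
    using that properly_coloured_pair[OF c, of v x] properly_coloured_pair[OF c, of x "\<phi> x"]
    by (auto simp: mem_edges_wide)
  have ne: "v \<noteq> s2" "\<And>x. x \<in> N \<Longrightarrow> \<phi> x \<noteq> s2" using vW s2W \<phi> by auto
  show ?thesis unfolding properly_coloured_def
  proof
    fix e assume "e \<in># edges narrow"
    then show "\<exists>a b. e = {#a, b#} \<and> (c(s2 := c s1)) a \<noteq> (c(s2 := c s1)) b"
      unfolding mem_edges_narrow
    proof (elim disjE insertE bexE emptyE)
      assume e: "e \<in># R"
      then have "e \<in># edges wide" by (simp add: mem_edges_wide)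
      then obtain a b where ab: "e = {#a, b#}" "c a \<noteq> c b"
        using c unfolding properly_coloured_def by blast
      moreover have "a \<noteq> s2" "b \<noteq> s2" using R[OF e] ab s2W by auto
      ultimately show ?thesis by (intro exI[of _ a] exI[of _ b]) auto
    next
      assume "e = {#v, s1#}"
      then show ?thesis using vx[of s1] ne s12 by (intro exI[of _ v] exI[of _ s1]) auto
    next
      assume "e = {#v, s2#}"
      then show ?thesis using vx[of s1] ne by (intro exI[of _ v] exI[of _ s2]) auto
    next
      assume "e = {#s1, \<phi> s1#}"
      then show ?thesis using x\<phi>[of s1] ne(2)[of s1] s12 by (intro exI[of _ s1] exI[of _ "\<phi> s1"]) auto
    next
      fix x assume "x \<in> X" "e = {#s2, \<phi> x#}"
      then show ?thesis using x\<phi>[of x] vx[of x] vx[of s1] ne(2)[of x]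
        by (intro exI[of _ s2] exI[of _ "\<phi> x"]) auto
    qed
  qed
qed

text \<open>The colouring is explicit because the induction later compares colour classes of the two
  graphs; outside \<open>X\<close> no colour changes.\<close>

lemma coloured_wide:
  assumes c: "properly_coloured c (edges narrow)"
  shows "properly_coloured (\<lambda>x. if x \<in> X then c s2 else c x) (edges wide)"
proof -
  let ?c = "\<lambda>x. if x \<in> X then c s2 else c x"
  have cc: "c v \<noteq> c s1" "c v \<noteq> c s2" "c s1 \<noteq> c (\<phi> s1)" "\<And>x. x \<in> X \<Longrightarrow> c s2 \<noteq> c (\<phi> x)"
    using properly_coloured_pair[OF c, of v s1] properly_coloured_pair[OF c, of v s2]
      properly_coloured_pair[OF c, of s1 "\<phi> s1"] properly_coloured_pair[OF c, of s2]
    by (auto simp: mem_edges_narrow)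
  have ne: "v \<notin> X" "\<And>x. x \<in> N \<Longrightarrow> \<phi> x \<notin> X" using vW XW \<phi> by auto
  show ?thesis unfolding properly_coloured_def
  proof
    fix e assume "e \<in># edges wide"
    then show "\<exists>a b. e = {#a, b#} \<and> ?c a \<noteq> ?c b"
      unfolding mem_edges_wide
    proof (elim disjE bexE)
      assume e: "e \<in># R"
      then have "e \<in># edges narrow" by (simp add: mem_edges_narrow)
      then obtain a b where ab: "e = {#a, b#}" "c a \<noteq> c b"
        using c unfolding properly_coloured_def by blast
      moreover have "a \<notin> X" "b \<notin> X" using R[OF e] ab XW by auto
      ultimately show ?thesis by (intro exI[of _ a] exI[of _ b]) auto
    next
      fix x assume "x \<in> N" "e = {#v, x#}"
      then show ?thesis using cc ne s1X by (intro exI[of _ v] exI[of _ x]) auto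
    next
      fix x assume "x \<in> N" "e = {#x, \<phi> x#}"
      then show ?thesis using cc ne(2)[of x] s1X by (intro exI[of _ x] exI[of _ "\<phi> x"]) auto
    qed
  qed
qed

text \<open>The merged vertex has degree at least 3, so its neighbours besides \<open>v\<close> must
  have degree 2, which the side condition of the contraction supplies. The other new edges contain
  \<open>v\<close> or \<open>s1\<close>, both of degree 2 in \<open>narrow\<close>.\<close>

lemma lean_narrow:
  assumes wide: "lean wide" and two: "\<And>x. x \<in> X \<Longrightarrow> degree wide (\<phi> x) = 2"
  shows "lean narrow"
proof -
  have "2 \<le> degree narrow y" if "y \<in> verts narrow" for y
  proof (cases "y \<in> W - {v}")
    case True
    moreover have "2 \<le> degree wide y" using wide True unfolding lean_def by (simp add: wide_def)
    ultimately show ?thesis using degree_wide_eq_narrow by simp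
  next
    case False
    then show ?thesis using that degree_narrow_v degree_narrow_s1 degree_narrow_s2 cardX
      by (auto simp: narrow_def)
  qed
  moreover have "\<exists>x\<in>#e. degree narrow x = 2" if "e \<in># edges narrow" for e
    using that unfolding mem_edges_narrow
  proof (elim disjE insertE bexE emptyE)
    assume e: "e \<in># R"
    then have "e \<in># edges wide" by (simp add: mem_edges_wide)
    then obtain x where x: "x \<in># e" "degree wide x = 2" using wide unfolding lean_def by blast
    then have "degree narrow x = 2" using R[OF e] degree_wide_eq_narrow[of x] by auto
    then show ?thesis using x by blast
  next
    fix x assume "x \<in> X" "e = {#s2, \<phi> x#}"
    then show ?thesis using two[of x] degree_wide_eq_narrow[of "\<phi> x"] \<phi>[of x] by auto
  qed (simp_all add: degree_narrow_v degree_narrow_s1)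
  ultimately show ?thesis
    using wide is_graph_narrow connected_narrow coloured_narrow unfolding lean_def by blast
qed

text \<open>Every edge outside \<open>R\<close> has an end in \<open>N\<close>, and all of
  \<open>N\<close> has degree 2, however large the degree of \<open>v\<close> becomes.\<close>

lemma lean_wide:
  assumes narrow: "lean narrow"
  shows "lean wide"
proof -
  have "2 \<le> degree wide y" if "y \<in> verts wide" for y
  proof (cases "y \<in> W - {v}")
    case True
    moreover have "2 \<le> degree narrow y" using narrow True unfolding lean_def by (simp add: narrow_def)
    ultimately show ?thesis using degree_wide_eq_narrow by simp
  next
    case False
    then show ?thesis using that degree_wide_v degree_wide_N cardX by (auto simp: wide_def)
  qed
  moreover have "\<exists>x\<in>#e. degree wide x = 2" if "e \<in># edges wide" for e
    using that unfolding mem_edges_wide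
  proof (elim disjE bexE)
    assume e: "e \<in># R"
    then have "e \<in># edges narrow" by (simp add: mem_edges_narrow)
    then obtain x where x: "x \<in># e" "degree narrow x = 2" using narrow unfolding lean_def by blast
    then have "degree wide x = 2" using R[OF e] degree_wide_eq_narrow[of x] by auto
    then show ?thesis using x by blast
  qed (use degree_wide_N in auto)
  ultimately show ?thesis
    using narrow is_graph_wide connected_wide coloured_wide unfolding lean_def by blast
qed

end

section \<open>The contraction of \<open>wide\<close> as a copy of \<open>narrow\<close>\<close>

lemma sum_singletons_eq_image_mset:
  "finite A \<Longrightarrow> (\<Sum>x\<in>A. {#F x#}) = image_mset F (mset_set A)"
  by (induction A rule: finite_induct) auto

text \<open>The contraction is defined by edge counts at each vertex \<open>u\<close>; grouping
  \<open>S\<close> by the fibres of \<open>\<phi>\<close> turns them into one edge per element of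
  \<open>S\<close>.\<close>

lemma sum_replicate_fibres:
  assumes "finite S" "finite T" "\<phi> ` S \<subseteq> T"
  shows "(\<Sum>u\<in>T. replicate_mset (card {x\<in>S. \<phi> x = u}) (F u)) = (\<Sum>x\<in>S. {#F (\<phi> x)#})"
proof -
  have "replicate_mset (card {x\<in>S. \<phi> x = u}) (F u) = (\<Sum>x\<in>{x\<in>S. \<phi> x = u}. {#F (\<phi> x)#})" for u
  proof -
    have "(\<Sum>x\<in>{x\<in>S. \<phi> x = u}. {#F (\<phi> x)#}) = (\<Sum>x\<in>{x\<in>S. \<phi> x = u}. {#F u#})"
      by (intro sum.cong) auto
    then show ?thesis
      using assms(1) by (simp add: sum_singletons_eq_image_mset image_mset_const_eq)
  qed
  then show ?thesis using sum.group[OF assms, of "\<lambda>x. {#F (\<phi> x)#}"] by simp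
qed

lemma filter_mset_sum: "filter_mset P (\<Sum>x\<in>A. F x) = (\<Sum>x\<in>A. filter_mset P (F x))"
  by (induction A rule: infinite_finite_induct) auto

context split_pair
begin

lemma nbhd_wide: "nbhd wide v = N"
proof -
  have "{#v, u#} \<in># edges wide \<longleftrightarrow> u \<in> N" for u
  proof
    assume "{#v, u#} \<in># edges wide"
    then show "u \<in> N"
      unfolding mem_edges_wide using R[of "{#v, u#}"] \<phi> notin_W vW
      by (auto simp only: pair_mset_eq_iff) auto
  qed (auto simp: mem_edges_wide)
  then show ?thesis by (auto simp: nbhd_def)
qed

lemma nbhd_wide_N:
  assumes "x \<in> N"
  shows "nbhd wide x = {v, \<phi> x}"
proof -
  have "{#x, u#} \<in># edges wide \<longleftrightarrow> u = v \<or> u = \<phi> x" for u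
  proof
    assume "{#x, u#} \<in># edges wide"
    then show "u = v \<or> u = \<phi> x"
      unfolding mem_edges_wide
    proof (elim disjE bexE)
      assume "{#x, u#} \<in># R"
      then show ?thesis using R[of "{#x, u#}"] notin_W[OF assms] by auto
    next
      fix y assume "{#x, u#} = {#v, y#}"
      then show ?thesis using notin_W[OF assms] vW by (auto simp: pair_mset_eq_iff)
    next
      fix y assume "y \<in> N" "{#x, u#} = {#y, \<phi> y#}"
      then show ?thesis using notin_W[OF assms] \<phi>[of y] by (auto simp: pair_mset_eq_iff)
    qed
  next
    assume "u = v \<or> u = \<phi> x"
    then show "{#x, u#} \<in># edges wide" using assms by (auto simp: mem_edges_wide add_mset_commute)
  qed
  then show ?thesis by (auto simp: nbhd_def)
qed

text \<open>A walk of length 2 from \<open>v\<close> passes through some \<open>x\<close> in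
  \<open>N\<close> and ends in \<open>v\<close> or \<open>\<phi> x\<close>; as
  \<open>\<phi> x\<close> lies in \<open>W - {v}\<close>, which is disjoint from \<open>N\<close>,
  it is no closer to \<open>v\<close>.\<close>

lemma at_distance_2_wide: "at_distance wide 2 v = \<phi> ` N"
proof -
  have adj: "(x, y) \<in> adj wide \<longleftrightarrow> y \<in> nbhd wide x" for x y by (simp add: adj_def nbhd_def)
  have two: "(v, u) \<in> adj wide ^^ 2 \<longleftrightarrow> u = v \<or> u \<in> \<phi> ` N" for u
    unfolding numeral_2_eq_2 relpow.simps using nbhd_wide nbhd_wide_N by (auto simp: adj relcomp_unfold)
  have less: "(\<forall>k<2. (v, u) \<notin> adj wide ^^ k) \<longleftrightarrow> u \<noteq> v \<and> u \<notin> N" for u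
    unfolding numeral_2_eq_2 using nbhd_wide by (auto simp: less_Suc_eq adj)
  show ?thesis
    unfolding at_distance_def two less using \<phi> notin_W by (auto simp: wide_def)
qed

text \<open>Edges of \<open>R\<close> avoid \<open>N\<close> and edges at \<open>v\<close> avoid
  \<open>u\<close>, so only the edges from \<open>x\<close> to \<open>\<phi> x\<close>
  count.\<close>

lemma edges_between_wide:
  assumes u: "u \<in> W - {v}" and S: "S \<subseteq> N"
  shows "edges_between wide {u} S = card {x\<in>S. \<phi> x = u}"
proof -
  let ?P = "\<lambda>e. \<exists>a\<in>{u}. \<exists>b\<in>S. e = {#a, b#}"
  have R0: "filter_mset ?P R = {#}"
    unfolding filter_mset_eq_mempty_iff using R S notin_W by fastforce
  have "size (filter_mset ?P {#{#v, x#}, {#x, \<phi> x#}#}) = (if x \<in> S \<and> \<phi> x = u then 1 else 0)"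
    if "x \<in> N" for x
  proof -
    have "\<not> ?P {#v, x#}" using u S notin_W[of u] notin_W[OF that] by (auto simp: pair_mset_eq_iff)
    moreover have "?P {#x, \<phi> x#} \<longleftrightarrow> x \<in> S \<and> \<phi> x = u"
      using u S notin_W[OF that] \<phi>[OF that] by (auto simp: pair_mset_eq_iff)
    ultimately show ?thesis by simp
  qed
  then have "(\<Sum>x\<in>N. size (filter_mset ?P {#{#v, x#}, {#x, \<phi> x#}#})) =
      (\<Sum>x\<in>N. if x \<in> S \<and> \<phi> x = u then 1 else 0)" by (rule sum.cong[OF refl])
  also have "\<dots> = card {x\<in>N. x \<in> S \<and> \<phi> x = u}"
    using sum.inter_filter[OF finN, of "\<lambda>_. 1::nat" "\<lambda>x. x \<in> S \<and> \<phi> x = u"] by (simp only: card_eq_sum)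
  also have "{x\<in>N. x \<in> S \<and> \<phi> x = u} = {x\<in>S. \<phi> x = u}" using S by auto
  finally show ?thesis using R0
    unfolding edges_between_def wide_def
    by (simp only: mgraph.simps filter_union_mset filter_mset_sum size_union size_multiset_sum size_empty add_0)
qed

lemma verts_contraction:
  "verts (contraction wide v {{s1}, X}) = Inl ` W \<union> {Inr (v, {s1}), Inr (v, X)}"
proof -
  have "verts wide - N = W" using notin_W by (auto simp: wide_def)
  then show ?thesis by (auto simp: contraction_def nbhd_wide)
qed

lemma edges_contraction:
  "edges (contraction wide v {{s1}, X}) = image_mset (image_mset Inl) R
     + {#{#Inl v, Inr (v, {s1})#}, {#Inl v, Inr (v, X)#}, {#Inl (\<phi> s1), Inr (v, {s1})#}#}
     + (\<Sum>x\<in>X. {#{#Inl (\<phi> x), Inr (v, X)#}#})"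
proof -
  \<comment> \<open>Sums over \<open>{{s1}, X}\<close> have two summands only because the blocks
    differ.\<close>
  have ne: "{s1} \<noteq> X" using s1X by auto
  have "filter_mset (\<lambda>e. set_mset e \<inter> N = {}) R = R"
    unfolding filter_mset_eq_conv using R notin_W by fastforce
  moreover have "filter_mset (\<lambda>e. set_mset e \<inter> N = {}) (\<Sum>x\<in>N. {#{#v, x#}, {#x, \<phi> x#}#}) = {#}"
    unfolding filter_mset_eq_mempty_iff set_mset_sum[OF finN] by auto
  ultimately have far: "filter_mset (\<lambda>e. set_mset e \<inter> N = {}) (edges wide) = R"
    by (simp add: wide_def del: sum.insert)
  \<comment> \<open>After swapping the sums, the fibres of \<open>\<phi>\<close> can be counted
    within one block at a time.\<close>
  have "(\<Sum>u\<in>\<phi> ` N. \<Sum>S\<in>{{s1}, X}. replicate_mset (edges_between wide {u} S) {#Inl u, Inr (v, S)#})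
      = (\<Sum>S\<in>{{s1}, X}. \<Sum>u\<in>\<phi> ` N. replicate_mset (edges_between wide {u} S) {#Inl u, Inr (v, S)#})"
    by (rule sum.swap)
  also have "\<dots> = (\<Sum>S\<in>{{s1}, X}. \<Sum>x\<in>S. {#{#Inl (\<phi> x), Inr (v, S)#}#})"
  proof (rule sum.cong[OF refl])
    fix S assume "S \<in> {{s1}, X}"
    then have S: "S \<subseteq> N" by auto
    have "(\<Sum>u\<in>\<phi> ` N. replicate_mset (edges_between wide {u} S) {#Inl u, Inr (v, S)#}) =
        (\<Sum>u\<in>\<phi> ` N. replicate_mset (card {x\<in>S. \<phi> x = u}) {#Inl u, Inr (v, S)#})"
      using \<phi> by (intro sum.cong) (auto simp: edges_between_wide[OF _ S])
    also have "\<dots> = (\<Sum>x\<in>S. {#{#Inl (\<phi> x), Inr (v, S)#}#})"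
      using S finite_subset[OF S finN] finX by (intro sum_replicate_fibres) auto
    finally show "(\<Sum>u\<in>\<phi> ` N. replicate_mset (edges_between wide {u} S) {#Inl u, Inr (v, S)#}) =
        (\<Sum>x\<in>S. {#{#Inl (\<phi> x), Inr (v, S)#}#})" .
  qed
  finally have near: "(\<Sum>u\<in>\<phi> ` N. \<Sum>S\<in>{{s1}, X}.
      replicate_mset (edges_between wide {u} S) {#Inl u, Inr (v, S)#}) =
      (\<Sum>S\<in>{{s1}, X}. \<Sum>x\<in>S. {#{#Inl (\<phi> x), Inr (v, S)#}#})" .
  show ?thesis
    unfolding contraction_def nbhd_wide at_distance_2_wide far near mgraph.simps using ne by simp
qed

lemma narrow_iso_contraction: "iso narrow (contraction wide v {{s1}, X})"
proof -
  let ?f = "\<lambda>y. if y = s1 then Inr (v, {s1}) else if y = s2 then Inr (v, X) else Inl y"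
  have W: "?f y = Inl y" if "y \<in> W" for y using that s1W s2W by auto
  have "inj_on ?f (verts narrow)" using s1X by (auto simp: inj_on_def split: if_splits)
  moreover have "?f ` verts narrow = Inl ` W \<union> {Inr (v, {s1}), Inr (v, X)}"
    using s12 s1W s2W by (auto simp: narrow_def image_iff)
  moreover have "edges (contraction wide v {{s1}, X}) = image_mset (image_mset ?f) (edges narrow)"
  proof -
    have "image_mset (image_mset ?f) R = image_mset (image_mset Inl) R"
      using R W by (intro image_mset_cong) (metis DiffD1 subset_iff)
    moreover have "image_mset (image_mset ?f) (\<Sum>x\<in>X. {#{#s2, \<phi> x#}#}) =
        (\<Sum>x\<in>X. {#{#Inl (\<phi> x), Inr (v, X)#}#})"
      unfolding image_mset_sum using W \<phi> s12 by (intro sum.cong) (auto simp: add_mset_commute)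
    ultimately show ?thesis
      unfolding edges_contraction narrow_def using W[OF vW] W[of "\<phi> s1"] \<phi>[of s1] s12
      by (simp add: add_mset_commute)
  qed
  ultimately show ?thesis
    unfolding iso_def bij_betw_def verts_contraction by (intro exI[of _ ?f]) blast
qed

lemma contractible_wide:
  assumes "lean wide"
  shows "contractible wide v"
proof -
  have "count (edges wide) {#v, u#} \<le> 1" for u
  proof -
    have "count R {#v, u#} = 0" using R[of "{#v, u#}"] by (auto simp: count_eq_zero_iff)
    moreover have "(\<Sum>x\<in>N. count {#{#v, x#}, {#x, \<phi> x#}#} {#v, u#}) = (\<Sum>x\<in>N. if x = u then 1 else 0)"
    proof (rule sum.cong[OF refl])
      fix x assume "x \<in> N"
      then have "v \<noteq> x" "v \<noteq> \<phi> x" using notin_W vW \<phi> by auto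
      then show "count {#{#v, x#}, {#x, \<phi> x#}#} {#v, u#} = (if x = u then 1 else 0)"
        by (auto simp: pair_mset_eq_iff)
    qed
    ultimately show ?thesis
      using sum.delta[OF finN, of u "\<lambda>_. 1::nat"] by (simp add: wide_def count_sum del: sum.insert)
  qed
  moreover have "bipartite wide"
    using assms bipartite_iff_properly_coloured unfolding lean_def by blast
  ultimately show ?thesis unfolding contractible_def using vW by (simp add: wide_def)
qed

end

section \<open>Lean graphs form the family\<close>

text \<open>\<open>w\<close> equals \<open>v\<close> in the case of a double edge; later uses rule
  this out by contractibility or by the degree of \<open>v\<close>.\<close>

lemma edges_at_degree_2:
  assumes c: "properly_coloured c (edges G)" and deg: "degree G x = 2" and e: "{#v, x#} \<in># edges G"
  shows "\<exists>w. filter_mset (\<lambda>e. x \<in># e) (edges G) = {#{#v, x#}, {#x, w#}#}"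
proof -
  have star: "\<forall>e\<in>#filter_mset (\<lambda>e. x \<in># e) (edges G). size e = 2 \<and> x \<in># e"
    using c unfolding properly_coloured_def by auto
  then obtain M where M: "filter_mset (\<lambda>e. x \<in># e) (edges G) = {#{#y, x#}. y \<in># M#}"
    using star_decomposition[OF star] by blast
  have "size M = 2" using size_edges_at[OF c, of x] deg by (simp add: M degree_eq_mdeg)
  moreover have "{#v, x#} \<in># {#{#y, x#}. y \<in># M#}" using e by (simp flip: M)
  then have "v \<in># M" by (auto simp: pair_mset_eq_iff)
  ultimately obtain w where "M = {#v, w#}"
    unfolding size_2_mset_conv by (auto simp: add_mset_commute)
  then show ?thesis using M by (auto simp: add_mset_commute)
qed

lemma edge_vertices:
  assumes "is_graph G" "{#x, y#} \<in># edges G"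
  shows "x \<in> verts G" "y \<in> verts G"
proof -
  have "set_mset {#x, y#} \<subseteq> verts G" using assms unfolding is_graph_def by blast
  then show "x \<in> verts G" "y \<in> verts G" by simp_all
qed

text \<open>Since \<open>v\<close> has degree at least 3, leanness gives all its neighbours degree
  2. Each then has one further edge, so \<open>G\<close> is \<open>wide\<close> for a suitable
  \<open>split_pair\<close>, and \<open>lean_narrow\<close> applies.\<close>

lemma lean_contraction:
  fixes G :: "'a mgraph"
  assumes inf: "infinite (UNIV :: 'a set)" and lean: "lean G" and v: "contractible G v"
    and deg: "3 \<le> degree G v"
    and P: "partition_on (nbhd G v) {S1, S2}" "S1 \<noteq> S2" and S1: "card S1 = 1"
    and two: "\<forall>u\<in>nbhd_set G S2 - {v}. degree G u = 2"
  shows "lean (contraction G v {S1, S2})"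
proof -
  obtain s1 where s1: "S1 = {s1}" using S1 by (auto simp: card_1_singleton_iff)
  define X where "X = S2"
  have NX: "nbhd G v = insert s1 X" and s1X: "s1 \<notin> X"
    using P s1 unfolding partition_on_def disjoint_def X_def by auto
  define N where "N = insert s1 X"
  have G: "is_graph G" using lean by (simp add: lean_def)
  obtain c where c: "properly_coloured c (edges G)" using lean unfolding lean_def by blast
  have vV: "v \<in> verts G" and cnt: "\<And>u. count (edges G) {#v, u#} \<le> 1"
    using v by (auto simp: contractible_def)
  have memN: "x \<in> N \<longleftrightarrow> {#v, x#} \<in># edges G" for x
    using NX unfolding N_def nbhd_def by auto
  have NV: "N \<subseteq> verts G" using memN edge_vertices[OF G] by blast
  then have finN: "finite N" using G finite_subset unfolding is_graph_def by blast
  have cN: "c x \<noteq> c v" if "x \<in> N" for x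
    using that properly_coloured_pair[OF c, of v x] by (simp add: memN)
  have "degree G x = 2" if "x \<in> N" for x
  proof -
    have "\<exists>y\<in>#{#v, x#}. degree G y = 2" using lean that unfolding lean_def memN by blast
    then show ?thesis using deg by auto
  qed
  then have "\<exists>w. filter_mset (\<lambda>e. x \<in># e) (edges G) = {#{#v, x#}, {#x, w#}#}" if "x \<in> N" for x
    using that edges_at_degree_2[OF c] by (simp add: memN)
  then obtain \<phi> where \<phi>:
    "\<And>x. x \<in> N \<Longrightarrow> filter_mset (\<lambda>e. x \<in># e) (edges G) = {#{#v, x#}, {#x, \<phi> x#}#}"
    by metis
  have \<phi>E: "{#x, \<phi> x#} \<in># edges G" if "x \<in> N" for x
  proof -
    have "{#x, \<phi> x#} \<in># filter_mset (\<lambda>e. x \<in># e) (edges G)" unfolding \<phi>[OF that] by simp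
    then show ?thesis by simp
  qed
  \<comment> \<open>Otherwise there would be a double edge at \<open>v\<close>, which
    contractibility forbids.\<close>
  have \<phi>v: "\<phi> x \<noteq> v" if "x \<in> N" for x
  proof
    assume "\<phi> x = v"
    then have "count (filter_mset (\<lambda>e. x \<in># e) (edges G)) {#v, x#} = 2"
      unfolding \<phi>[OF that] by (simp add: add_mset_commute)
    then show False using cnt[of x] by simp
  qed
  \<comment> \<open>\<open>\<phi> x\<close> has the colour of \<open>v\<close>, opposite to that of
    \<open>N\<close>.\<close>
  have \<phi>V: "\<phi> x \<in> verts G - N - {v}" if "x \<in> N" for x
    using edge_vertices[OF G \<phi>E[OF that]] \<phi>v[OF that] cN[OF that] cN[of "\<phi> x"]
      properly_coloured_pair[OF c \<phi>E[OF that]] by auto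
  define R where "R = filter_mset (\<lambda>e. set_mset e \<inter> N = {}) (edges G)"
  have "edges G = R + (\<Sum>x\<in>N. filter_mset (\<lambda>e. x \<in># e) (edges G))"
    unfolding R_def
  proof (rule decompose_at_independent[OF finN])
    fix e x y assume e: "e \<in># edges G" "x \<in># e" "y \<in># e" "x \<in> N" "y \<in> N"
    then show "x = y" using cN[of x] cN[of y] by (intro properly_coloured_unique_end[OF c]) auto
  qed
  moreover have "(\<Sum>x\<in>N. filter_mset (\<lambda>e. x \<in># e) (edges G)) = (\<Sum>x\<in>N. {#{#v, x#}, {#x, \<phi> x#}#})"
    using \<phi> by (rule sum.cong[OF refl])
  ultimately have EG: "edges G = R + (\<Sum>x\<in>N. {#{#v, x#}, {#x, \<phi> x#}#})" by metis
  have R: "size e = 2 \<and> set_mset e \<subseteq> verts G - N - {v}" if "e \<in># R" for e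
  proof -
    have e: "e \<in># edges G" "set_mset e \<inter> N = {}" using that by (auto simp: R_def)
    have "v \<notin># e"
    proof
      assume ve: "v \<in># e"
      obtain a b where "e = {#a, b#}" using c e unfolding properly_coloured_def by blast
      then obtain y where "e = {#v, y#}" using ve by (auto simp: add_mset_commute)
      then show False using e memN by auto
    qed
    then show ?thesis using e G unfolding is_graph_def by blast
  qed
  have "v \<notin> N" using cN by auto
  \<comment> \<open>Each neighbour accounts for one edge at \<open>v\<close>, so degree at least 3
    leaves at least two elements for \<open>X\<close>.\<close>
  have "degree G v = card N"
  proof -
    have "mdeg R v = 0" unfolding mdeg_eq_0_iff using R by blast
    moreover have "(\<Sum>x\<in>N. mdeg {#{#v, x#}, {#x, \<phi> x#}#} v) = (\<Sum>x\<in>N. 1)"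
      using \<open>v \<notin> N\<close> \<phi>v by (intro sum.cong) auto
    ultimately show ?thesis unfolding degree_eq_mdeg by (subst EG) simp
  qed
  then have cardX: "2 \<le> card X" using deg finN s1X by (simp add: N_def)
  obtain s2 where s2: "s2 \<notin> verts G"
    using ex_new_if_finite[OF inf] G unfolding is_graph_def by blast
  interpret split_pair "verts G - N" R v s1 s2 X \<phi>
  proof
    show "finite (verts G - N)" using G by (simp add: is_graph_def)
  qed (use vV \<open>v \<notin> N\<close> R s2 NV finN s1X cardX \<phi>V in \<open>auto simp: N_def\<close>)
  have "wide = \<lparr>verts = verts G - N \<union> N, edges = R + (\<Sum>x\<in>N. {#{#v, x#}, {#x, \<phi> x#}#})\<rparr>"
    unfolding wide_def unfolding N_def ..
  then have "G = wide" using EG NV by (intro mgraph.equality) auto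
  moreover have "degree G (\<phi> x) = 2" if "x \<in> X" for x
  proof -
    have "\<phi> x \<in> nbhd_set G S2 - {v}"
      using \<phi>E[of x] \<phi>v[of x] that by (auto simp: N_def nbhd_set_def nbhd_def X_def)
    then show ?thesis using two by blast
  qed
  ultimately have "lean narrow" using lean_narrow lean by simp
  then show ?thesis
    using iso_lean[OF _ narrow_iso_contraction] \<open>G = wide\<close> s1 by (simp add: X_def)
qed

theorem family_nat_lean: "family_nat G \<Longrightarrow> lean G"
proof (induction rule: family_nat.induct)
  case (subdiv H G)
  then show ?case using iso_lean[OF subdivision_lean] by blast
next
  case (contract G v S1 S2 G')
  then have "lean (contraction G v {S1, S2})" by (intro lean_contraction[OF infinite_UNIV_nat])
  then show ?case using contract.hyps iso_lean by blast
qed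

section \<open>Undoing a contraction\<close>

lemma ex_fresh_indexing:
  assumes inf: "infinite (UNIV :: 'a set)" and V: "finite V"
  shows "\<exists>(X :: 'a set) \<phi>. finite X \<and> X \<inter> V = {} \<and> image_mset \<phi> (mset_set X) = U"
proof (induction U)
  case empty
  have "finite {} \<and> {} \<inter> V = {} \<and> image_mset \<phi> (mset_set {}) = {#}" for \<phi> :: "'a \<Rightarrow> 'b"
    by simp
  then show ?case by blast
next
  case (add u U)
  from add.IH obtain X and \<phi> :: "'a \<Rightarrow> 'b" where X: "finite X" "X \<inter> V = {}" "image_mset \<phi> (mset_set X) = U"
    by blast
  obtain x where x: "x \<notin> X \<union> V" using ex_new_if_finite[OF inf] X(1) V by blast
  have "image_mset (\<phi>(x := u)) (mset_set X) = U"
    unfolding X(3)[symmetric] using x X(1) by (intro image_mset_cong) auto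
  then have "image_mset (\<phi>(x := u)) (mset_set (insert x X)) = add_mset u U"
    using X(1) x by (simp add: fun_upd_same del: fun_upd_apply)
  moreover have "finite (insert x X)" "insert x X \<inter> V = {}" using X x by auto
  ultimately show ?case by blast
qed

text \<open>The vertex \<open>v\<close> is used up by its edges to \<open>s1\<close> and
  \<open>s2\<close>, and the other edges at \<open>s2\<close> supply \<open>\<phi>\<close> on
  \<open>X\<close>; so a path of this kind gives \<open>G\<close> the shape of
  \<open>narrow\<close>.\<close>

lemma ex_split_pair_narrow:
  fixes G :: "'a mgraph"
  assumes inf: "infinite (UNIV :: 'a set)" and G: "is_graph G" and c: "properly_coloured c (edges G)"
    and v: "degree G v = 2" and s1: "degree G s1 = 2" and s2: "3 \<le> degree G s2"
    and e1: "{#v, s1#} \<in># edges G" and e2: "{#v, s2#} \<in># edges G"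
  shows "\<exists>W R X \<phi>. split_pair W R v s1 s2 X \<phi> \<and> G = split_pair.narrow W R v s1 s2 X \<phi>"
proof -
  have ne: "s1 \<noteq> s2" using s1 s2 by auto
  have cs: "c s1 \<noteq> c v" "c s2 \<noteq> c v"
    using properly_coloured_pair[OF c e1] properly_coloured_pair[OF c e2] by auto
  obtain u1 where u1: "filter_mset (\<lambda>e. s1 \<in># e) (edges G) = {#{#v, s1#}, {#s1, u1#}#}"
    using edges_at_degree_2[OF c s1 e1] by blast
  have star: "\<forall>e\<in>#filter_mset (\<lambda>e. s2 \<in># e) (edges G). size e = 2 \<and> s2 \<in># e"
    using c unfolding properly_coloured_def by auto
  then obtain M where M: "filter_mset (\<lambda>e. s2 \<in># e) (edges G) = {#{#y, s2#}. y \<in># M#}"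
    using star_decomposition[OF star] by blast
  have "{#v, s2#} \<in># {#{#y, s2#}. y \<in># M#}" using e2 by (simp flip: M)
  then have "v \<in># M" by (auto simp: pair_mset_eq_iff)
  then obtain U where U: "M = add_mset v U" by (meson mset_add)
  have sizeU: "Suc (size U) = degree G s2"
    using size_edges_at[OF c, of s2] by (simp add: M U degree_eq_mdeg)
  define R where "R = filter_mset (\<lambda>e. set_mset e \<inter> {s1, s2} = {}) (edges G)"
  have "edges G = R + (\<Sum>x\<in>{s1, s2}. filter_mset (\<lambda>e. x \<in># e) (edges G))"
    unfolding R_def
  proof (rule decompose_at_independent)
    fix e x y assume e: "e \<in># edges G" "x \<in># e" "y \<in># e" "x \<in> {s1, s2}" "y \<in> {s1, s2}"
    then show "x = y" using cs by (intro properly_coloured_unique_end[OF c]) auto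
  qed simp
  also have "(\<Sum>x\<in>{s1, s2}. filter_mset (\<lambda>e. x \<in># e) (edges G)) =
      {#{#v, s1#}, {#s1, u1#}#} + add_mset {#v, s2#} {#{#y, s2#}. y \<in># U#}"
    using ne by (simp only: sum.insert finite.intros insert_iff empty_iff simp_thms sum.empty u1 M U) simp
  finally have EG: "edges G = R + {#{#v, s1#}, {#v, s2#}, {#s1, u1#}#} + {#{#y, s2#}. y \<in># U#}"
    by (simp add: add_mset_commute)
  have "s1 \<noteq> v" "s2 \<noteq> v" using cs by auto
  \<comment> \<open>The edges to \<open>s1\<close> and \<open>s2\<close> exhaust the degree 2 of
    \<open>v\<close>, so it occurs neither in \<open>R\<close> nor as \<open>u1\<close> nor in
    \<open>U\<close>.\<close>
  then have vR: "mdeg R v = 0" and "u1 \<noteq> v" and "v \<notin># U"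
    using v unfolding degree_eq_mdeg EG by (auto simp: mdeg_star not_in_iff split: if_splits)
  \<comment> \<open>One fresh vertex for each edge at \<open>s2\<close> other than the one to
    \<open>v\<close>: these are the parts into which \<open>s2\<close> is split.\<close>
  obtain X :: "'a set" and \<psi> where X: "finite X" "X \<inter> verts G = {}" "image_mset \<psi> (mset_set X) = U"
    using ex_fresh_indexing[OF inf, of "verts G" U] G unfolding is_graph_def by blast
  have vV: "v \<in> verts G" "s1 \<in> verts G" "s2 \<in> verts G"
    using edge_vertices[OF G e1] edge_vertices[OF G e2] by auto
  then have s1X: "s1 \<notin> X" using X by auto
  define \<phi> where "\<phi> = \<psi>(s1 := u1)"
  have \<phi>X: "\<phi> x \<in># U" if "x \<in> X" for x
  proof -
    have "\<psi> x \<in># image_mset \<psi> (mset_set X)" using that X(1) by auto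
    then show ?thesis using that s1X X(3) by (auto simp: \<phi>_def)
  qed
  have UE: "y \<in> verts G - {s1, s2} - {v}" if "y \<in># U" for y
  proof -
    have e: "{#y, s2#} \<in># edges G" using that unfolding EG by auto
    then show ?thesis
      using edge_vertices[OF G e] properly_coloured_pair[OF c e] cs \<open>v \<notin># U\<close> that by auto
  qed
  have u1E: "u1 \<in> verts G - {s1, s2} - {v}"
  proof -
    have e: "{#s1, u1#} \<in># edges G" unfolding EG by auto
    then show ?thesis
      using edge_vertices[OF G e] properly_coloured_pair[OF c e] cs \<open>u1 \<noteq> v\<close> by auto
  qed
  have R: "size e = 2 \<and> set_mset e \<subseteq> verts G - {s1, s2} - {v}" if "e \<in># R" for e
  proof -
    have "v \<notin># e" using vR that unfolding mdeg_eq_0_iff by blast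
    moreover have "e \<in># edges G" "set_mset e \<inter> {s1, s2} = {}" using that by (auto simp: R_def)
    ultimately show ?thesis using G unfolding is_graph_def by blast
  qed
  have "card X = size U" using X(1,3) by (metis size_image_mset size_mset_set)
  then have cardX: "2 \<le> card X" using sizeU s2 by simp
  interpret split_pair "verts G - {s1, s2}" R v s1 s2 X \<phi>
  proof
    show "finite (verts G - {s1, s2})" using G by (simp add: is_graph_def)
    show "\<phi> x \<in> verts G - {s1, s2} - {v}" if "x \<in> insert s1 X" for x
      using that UE[OF \<phi>X[of x]] u1E by (auto simp: \<phi>_def)
  qed (use vV \<open>s1 \<noteq> v\<close> \<open>s2 \<noteq> v\<close> R X s1X ne cardX in auto)
  have "{#{#y, s2#}. y \<in># U#} = {#{#s2, \<phi> x#}. x \<in># mset_set X#}"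
    unfolding X(3)[symmetric] multiset.map_comp using X(1) s1X
    by (intro image_mset_cong) (auto simp: \<phi>_def add_mset_commute)
  then have "edges G = edges narrow"
    unfolding EG narrow_def using X(1) by (simp add: sum_singletons_eq_image_mset \<phi>_def)
  then have "G = narrow" using vV by (intro mgraph.equality) (auto simp: narrow_def)
  then show ?thesis using split_pair_axioms by blast
qed

text \<open>From \<open>s2\<close> one reaches only vertices of colour \<open>False\<close> and
  degree at least 3, and their neighbours. A neighbour \<open>x\<close> of such a vertex
  \<open>b\<close> has degree 2 by leanness, and a neighbour \<open>y\<close> of \<open>x\<close>
  with degree 2 would complete the excluded path \<open>y\<close>, \<open>x\<close>,
  \<open>b\<close>.\<close>

lemma opposite_class_degree_2:
  assumes lean: "lean G" and c: "properly_coloured c (edges G)"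
    and s2: "s2 \<in> verts G" "\<not> c s2" "3 \<le> degree G s2"
    and no: "\<And>v s1 s2. {#v, s1#} \<in># edges G \<Longrightarrow> {#v, s2#} \<in># edges G \<Longrightarrow> \<not> c s2 \<Longrightarrow>
       degree G v = 2 \<Longrightarrow> degree G s1 = 2 \<Longrightarrow> 3 \<le> degree G s2 \<Longrightarrow> False"
    and a: "a \<in> verts G" "c a"
  shows "degree G a = 2"
proof -
  have G: "is_graph G" and conn: "connected_graph G" and ge2: "\<And>x. x \<in> verts G \<Longrightarrow> 2 \<le> degree G x"
    and two: "\<And>e. e \<in># edges G \<Longrightarrow> \<exists>x\<in>#e. degree G x = 2"
    using lean unfolding lean_def by auto
  let ?big = "\<lambda>b. \<not> c b \<and> 3 \<le> degree G b"
  have nbr: "degree G x = 2" if "{#x, b#} \<in># edges G" "?big b" for x b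
    using two[OF that(1)] that(2) by auto
  have "?big x \<or> (c x \<and> (\<exists>b. {#x, b#} \<in># edges G \<and> ?big b))" if "(s2, x) \<in> (adj G)\<^sup>*" for x
    using that
  proof (induction rule: rtrancl_induct)
    case base
    then show ?case using s2 by blast
  next
    case (step x y)
    then have e: "{#x, y#} \<in># edges G" "{#y, x#} \<in># edges G" by (auto simp: adj_def add_mset_commute)
    have cc: "c x \<noteq> c y" using properly_coloured_pair[OF c e(1)] .
    from step.IH show ?case
    proof
      assume "?big x"
      then show ?thesis using e cc by blast
    next
      assume "c x \<and> (\<exists>b. {#x, b#} \<in># edges G \<and> ?big b)"
      then obtain b where b: "c x" "{#x, b#} \<in># edges G" "?big b" by blast
      then have "degree G y \<noteq> 2" using no[OF e(1) b(2)] nbr by blast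
      then show ?thesis using ge2[of y] edge_vertices[OF G e(1)] cc b(1) by auto
    qed
  qed
  moreover have "(s2, a) \<in> (adj G)\<^sup>*" using conn s2 a unfolding connected_graph_def by blast
  ultimately show ?thesis using a nbr by blast
qed

theorem lean_imp_family_nat:
  assumes "lean G" "properly_coloured c (edges G)"
  shows "family_nat G"
  using assms
proof (induction "card {b\<in>verts G. \<not> c b \<and> 3 \<le> degree G b}" arbitrary: G c rule: less_induct)
  case less
  note lean = less.prems(1) and c = less.prems(2)
  have G: "is_graph G" and ge2: "\<And>x. x \<in> verts G \<Longrightarrow> 2 \<le> degree G x"
    using lean unfolding lean_def by auto
  have subdiv: "family_nat G" if "properly_coloured d (edges G)"
    "\<And>a. a \<in> verts G \<Longrightarrow> d a \<Longrightarrow> degree G a = 2" for d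
    using lean_imp_iso_subdivision[OF lean that] family_nat.subdiv by blast
  \<comment> \<open>If no vertex is counted, it is the class of colour \<open>False\<close> that has
    degree 2 throughout; swapping the colours puts it in the role expected by
    \<open>subdiv\<close>.\<close>
  have c': "properly_coloured (\<lambda>x. \<not> c x) (edges G)"
    using c by (auto simp: properly_coloured_def)
  show ?case
  proof (cases "\<exists>s2\<in>verts G. \<not> c s2 \<and> 3 \<le> degree G s2")
    case False
    have "degree G a = 2" if "a \<in> verts G" "\<not> c a" for a
    proof -
      have "\<not> 3 \<le> degree G a" using False that by blast
      then show ?thesis using ge2[OF that(1)] by simp
    qed
    then show ?thesis using subdiv[OF c'] by blast
  next
    case True
    then obtain b where b: "b \<in> verts G" "\<not> c b" "3 \<le> degree G b" by blast
    show ?thesis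
    proof (cases "\<exists>v s1 s2. {#v, s1#} \<in># edges G \<and> {#v, s2#} \<in># edges G \<and> \<not> c s2 \<and>
        degree G v = 2 \<and> degree G s1 = 2 \<and> 3 \<le> degree G s2")
      case False
      then have "degree G a = 2" if "a \<in> verts G" "c a" for a
        using opposite_class_degree_2[OF lean c b _ that] by blast
      then show ?thesis using subdiv[OF c] by blast
    next
      case True
      then obtain v s1 s2 where e: "{#v, s1#} \<in># edges G" "{#v, s2#} \<in># edges G" and s2: "\<not> c s2"
        and d: "degree G v = 2" "degree G s1 = 2" "3 \<le> degree G s2" by blast
      obtain W R X \<phi> where sp: "split_pair W R v s1 s2 X \<phi>"
        and Gn: "G = split_pair.narrow W R v s1 s2 X \<phi>"
        using ex_split_pair_narrow[OF infinite_UNIV_nat G c d e] by blast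
      interpret split_pair W R v s1 s2 X \<phi> by (rule sp)
      have lw: "lean wide" using lean_wide lean Gn by simp
      let ?c = "\<lambda>x. if x \<in> X then c s2 else c x"
      have cw: "properly_coloured ?c (edges wide)" using coloured_wide c Gn by simp
      have cv: "c v" using properly_coloured_pair[OF c e(2)] s2 by simp
      \<comment> \<open>Nothing new is counted in \<open>wide\<close>: the vertices of
        \<open>N\<close> have degree 2 and \<open>v\<close>, though now of degree at least 3, has
        colour \<open>True\<close>. Meanwhile \<open>s2\<close> is lost.\<close>
      have "{b\<in>verts wide. \<not> ?c b \<and> 3 \<le> degree wide b} \<subseteq> {b\<in>verts G. \<not> c b \<and> 3 \<le> degree G b} - {s2}"
      proof
        fix y assume y: "y \<in> {b\<in>verts wide. \<not> ?c b \<and> 3 \<le> degree wide b}"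
        then have "y \<notin> N" using degree_wide_N[of y] by auto
        moreover have "v \<notin> X" using XW vW by blast
        then have "y \<noteq> v" using y cv by auto
        ultimately have "y \<in> W - {v}" using y by (auto simp: wide_def)
        then show "y \<in> {b\<in>verts G. \<not> c b \<and> 3 \<le> degree G b} - {s2}"
          using y \<open>y \<notin> N\<close> degree_wide_eq_narrow[of y] s2W by (auto simp: Gn narrow_def)
      qed
      moreover have "s2 \<in> {b\<in>verts G. \<not> c b \<and> 3 \<le> degree G b}"
        using s2 d edge_vertices[OF G e(2)] by simp
      moreover have "finite {b\<in>verts G. \<not> c b \<and> 3 \<le> degree G b}" using G by (simp add: is_graph_def)
      ultimately have "card {b\<in>verts wide. \<not> ?c b \<and> 3 \<le> degree wide b}
          < card {b\<in>verts G. \<not> c b \<and> 3 \<le> degree G b}"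
        by (intro psubset_card_mono) blast+
      then have fam: "family_nat wide" by (rule less.hyps[OF _ lw cw])
      \<comment> \<open>The edge of \<open>G\<close> from \<open>s2\<close> to
        \<open>\<phi> x\<close> needs an end of degree 2, and \<open>s2\<close> is not one.\<close>
      have "\<forall>u\<in>nbhd_set wide X - {v}. degree wide u = 2"
      proof
        fix u assume "u \<in> nbhd_set wide X - {v}"
        then obtain x where x: "x \<in> X" "u \<in> nbhd wide x" "u \<noteq> v"
          unfolding nbhd_set_def by blast
        then have u: "u = \<phi> x" using nbhd_wide_N[of x] by auto
        have "{#s2, u#} \<in># edges narrow" using x u by (auto simp: mem_edges_narrow)
        then have "\<exists>x\<in>#{#s2, u#}. degree G x = 2" using lean unfolding Gn lean_def by blast
        then have "degree narrow u = 2" using d(3) Gn by auto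
        then show "degree wide u = 2" using degree_wide_eq_narrow[of u] \<phi>[of x] x u by simp
      qed
      moreover have "partition_on (nbhd wide v) {{s1}, X}" "{s1} \<noteq> X"
        using s1X cardX by (auto simp: partition_on_def disjoint_def nbhd_wide)
      moreover have "3 \<le> degree wide v" using degree_wide_v cardX by simp
      moreover have "iso (contraction wide v {{s1}, X}) G"
        using iso_sym[OF is_graph_narrow narrow_iso_contraction] Gn by simp
      ultimately show ?thesis
        using family_nat.contract[OF fam contractible_wide[OF lw]] by simp
    qed
  qed
qed

theorem theorem3p3:
  fixes G :: "'a mgraph"
  assumes "is_graph G" and "connected_graph G"
  shows "minimal_dominated22 G \<longleftrightarrow> in_family G"
proof -
  have "lean G \<longleftrightarrow> in_family G"
  proof
    assume lean: "lean G"
    \<comment> \<open>The family is generated over \<open>nat\<close>, so the graph is first copied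
      there; this also makes fresh vertices available for the splittings.\<close>
    obtain G' :: "nat mgraph" where iso: "iso G G'" "iso G' G" using ex_iso_nat[OF assms(1)] by blast
    have "lean G'" using iso_lean[OF lean iso(1)] .
    then have "family_nat G'" using lean_imp_family_nat unfolding lean_def by blast
    then show "in_family G" using iso(2) unfolding in_family_def by blast
  next
    assume "in_family G"
    then show "lean G" using family_nat_lean iso_lean unfolding in_family_def by blast
  qed
  then show ?thesis using minimal_dominated22_iff_lean[OF assms] by simp
qed

end
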